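(* Let $A=I-A_1\in\mathcal{QT}_\infty$ with $A_1\ge 0$ and $\|A_1\|_\infty<1$. Let $B=T(b)+E_B\in\mathcal{QT}_\infty$ (with Toeplitz part $T(b)$ and correction part $E_B$) be such that $I-B$ is the unique quasi-Toeplitz $M$-matrix with $(I-B)^2=A$; thus $B\ge 0$ and $\|B\|_\infty<1$. Put $S=(2I-T(b))^{-1}$, $R=T(b)^2-2T(b)+A_1$, and consider the doubling scheme $$\begin{aligned} E_{k+1}&=E_k(I-Q_kP_k)^{-1}E_k,\\ P_{k+1}&=P_k+F_k(I-P_kQ_k)^{-1}P_kE_k,\\ F_{k+1}&=F_k(I-P_kQ_k)^{-1}F_k,\\ Q_{k+1}&=Q_k+E_k(I-Q_kP_k)^{-1}Q_kF_k, \end{aligned}\qquad k\ge 0,$$ with $E_0=SA_1$, $P_0=SR$, $F_0=Q_0=S$. If the scheme can be carried out with no breakdown (that is, $I-Q_kP_k$ and $I-P_kQ_k$ are invertible for all $k\ge 0$), then the sequence $\{P_k\}$ converges to $E_B$ and $$\lim_{k\to\infty}\|E_B-P_k\|_\infty^{1/2^k}\le \rho(B)\,\rho(Z),$$ where $V=(2I-B)^{-1}$ and $Z=(I-T(b)V)(2I-B)^{-1}(I-T(b)V)^{-1}$.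
   Context: The Wiener algebra is $\mathcal W=\{a(z)=\sum_{i\in\mathbb Z}a_iz^i : |z|=1,\ \|a\|_{\mathcal W}:=\sum_{i\in\mathbb Z}|a_i|<\infty\}$. For $a\in\mathcal W$, $T(a)$ is the semi-infinite Toeplitz matrix with entries $(T(a))_{i,j}=a_{j-i}$, $i,j\in\mathbb Z^+=\{1,2,\dots\}$. Let $\mathcal K_d(\ell^\infty)$ be the set of infinite matrices $E=(e_{i,j})_{i,j\in\mathbb Z^+}$ (representing bounded operators on $\ell^\infty$) with $\lim_{i\to\infty}\sum_{j=1}^\infty|e_{i,j}|=0$. The class of quasi-Toeplitz matrices is $\mathcal{QT}_\infty=\{T(a)+E : a\in\mathcal W,\ E\in\mathcal K_d(\ell^\infty)\}$; it is a Banach algebra of bounded operators on $\ell^\infty$ with the norm $\|A\|_\infty=\sup_i\sum_{j=1}^\infty|a_{i,j}|$. For $A=T(a)+E\in\mathcal{QT}_\infty$, $T(a)$ is the Toeplitz part and $E$ the correction part of $A$. For an infinite matrix, $B\ge 0$ means that all entries are nonnegative; $I$ is the infinite identity matrix; $\rho(\cdot)$ is the spectral radius. A matrix $A\in\mathcal{QT}_\infty$ is an $M$-matrix if $A=\beta I-P$ with $P\ge 0$ and $\beta\ge\rho(P)$, and an invertible $M$-matrix if $\beta>\rho(P)$. It is known that if $A_1\in\mathcal{QT}_\infty$, $A_1\ge0$, $\|A_1\|_\infty<1$, there is a unique $B\in\mathcal{QT}_\infty$ with $B\ge 0$, $\|B\|_\infty<1$ and $(I-B)^2=I-A_1$.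
   Formalization: The limit of ‖E_B − P_k‖^{1/2^k} need not exist (e.g. A_1 with subdiagonal entries α − ε_i, with ε_i decreasing to 0 irregularly), so the bound ρ(B)ρ(Z) is stated for the limit superior; when the limit exists this is the stated bound. *)

theory Defs
  imports "HOL-Analysis.Analysis"
begin

no_notation Infinite_Set_Sum.abs_summable_on (infix \<open>abs'_summable'_on\<close> 50)

text \<open>
  Infinite complex matrices are indexed by \<^typ>\<open>nat\<close>, i.e. from 0 rather than from 1. Nothing
  depends on the offset: Toeplitz matrices only see the difference of the two indices.

  \<open>linf_mat\<close> consists of the infinite matrices that represent bounded operators on
  \<open>\<ell>\<^sup>\<infinity>\<close>, which are exactly the ones with uniformly bounded absolute row sums.
\<close>

definition row_sum :: "(nat \<Rightarrow> nat \<Rightarrow> complex) \<Rightarrow> nat \<Rightarrow> real" where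
  "row_sum A i = (\<Sum>\<^sub>\<infinity>j. norm (A i j))"

definition bounded_matrix :: "(nat \<Rightarrow> nat \<Rightarrow> complex) \<Rightarrow> bool" where
  "bounded_matrix A \<longleftrightarrow> (\<forall>i. A i abs_summable_on UNIV) \<and> bdd_above (range (row_sum A))"

lemma bounded_matrixI:
  assumes "\<And>i. A i abs_summable_on UNIV" "\<And>i. row_sum A i \<le> K"
  shows "bounded_matrix A"
  using assms unfolding bounded_matrix_def by (auto intro!: bdd_aboveI[of _ K])

lemma bounded_matrixD:
  assumes "bounded_matrix A"
  shows "A i abs_summable_on UNIV" "row_sum A i \<le> (SUP i. row_sum A i)"
  using assms unfolding bounded_matrix_def by (auto intro!: cSUP_upper)

lemma row_sum_nonneg: "row_sum A i \<ge> 0"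
  unfolding row_sum_def by (intro infsum_nonneg) auto

lemma row_sum_0 [simp]: "row_sum (\<lambda>i j. 0) i = 0"
  by (simp add: row_sum_def)

lemma abs_summable_delta: "(\<lambda>j. if i = j then c else 0) abs_summable_on (UNIV :: nat set)"
proof -
  have "(\<lambda>j. norm (if i = j then c else 0)) summable_on {i}"
    by (rule summable_on_finite) auto
  then show ?thesis
    by (rule summable_on_cong_neutral[THEN iffD1, rotated 3]) auto
qed

lemma infsum_delta:
  fixes f :: "nat \<Rightarrow> 'a :: {comm_monoid_add, t2_space}"
  assumes "\<And>j. j \<noteq> i \<Longrightarrow> f j = 0"
  shows "(\<Sum>\<^sub>\<infinity>j. f j) = f i"
proof -
  have "(\<Sum>\<^sub>\<infinity>j. f j) = (\<Sum>\<^sub>\<infinity>j\<in>{i}. f j)"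
    by (rule infsum_cong_neutral) (use assms in auto)
  then show ?thesis by simp
qed

lemma row_sum_one [simp]: "row_sum (\<lambda>i j. if i = j then 1 else 0) i = 1"
  unfolding row_sum_def by (subst infsum_delta[where i = i]) auto

lemma row_sum_add_le:
  assumes "bounded_matrix A" "bounded_matrix B"
  shows "(\<lambda>j. A i j + B i j) abs_summable_on UNIV"
    and "row_sum (\<lambda>i j. A i j + B i j) i \<le> row_sum A i + row_sum B i"
proof -
  note s = bounded_matrixD(1)[OF assms(1), of i] bounded_matrixD(1)[OF assms(2), of i]
  have s2: "(\<lambda>j. norm (A i j) + norm (B i j)) summable_on UNIV"
    using s by (rule summable_on_add)
  show *: "(\<lambda>j. A i j + B i j) abs_summable_on UNIV"
    by (rule summable_on_comparison_test[OF s2]) (auto intro: norm_triangle_ineq)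
  have "row_sum (\<lambda>i j. A i j + B i j) i \<le> (\<Sum>\<^sub>\<infinity>j. norm (A i j) + norm (B i j))"
    unfolding row_sum_def by (rule infsum_mono[OF * s2]) (rule norm_triangle_ineq)
  also have "\<dots> = row_sum A i + row_sum B i"
    unfolding row_sum_def by (rule infsum_add[OF s])
  finally show "row_sum (\<lambda>i j. A i j + B i j) i \<le> row_sum A i + row_sum B i" .
qed

lemma row_sum_scale: "row_sum (\<lambda>i j. c * A i j) i = norm c * row_sum A i"
  unfolding row_sum_def by (simp add: norm_mult infsum_cmult_right')

lemma bounded_matrix_zero: "bounded_matrix (\<lambda>i j. 0)"
  by (rule bounded_matrixI[where K = 0]) auto

lemma bounded_matrix_one: "bounded_matrix (\<lambda>i j. if i = j then 1 else 0)"
  by (rule bounded_matrixI[where K = 1]) (auto intro: abs_summable_delta)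

lemma bounded_matrix_add:
  assumes "bounded_matrix A" "bounded_matrix B"
  shows "bounded_matrix (\<lambda>i j. A i j + B i j)"
proof (rule bounded_matrixI)
  show "row_sum (\<lambda>i j. A i j + B i j) i \<le> (SUP i. row_sum A i) + (SUP i. row_sum B i)" for i
    using row_sum_add_le(2)[OF assms, of i] bounded_matrixD(2)[OF assms(1), of i]
      bounded_matrixD(2)[OF assms(2), of i] by linarith
qed (rule row_sum_add_le(1)[OF assms])

lemma bounded_matrix_scale:
  assumes "bounded_matrix A"
  shows "bounded_matrix (\<lambda>i j. c * A i j)"
proof (rule bounded_matrixI)
  show "(\<lambda>j. c * A i j) abs_summable_on UNIV" for i
    unfolding norm_mult by (intro summable_on_cmult_right bounded_matrixD(1) assms)
  show "row_sum (\<lambda>i j. c * A i j) i \<le> norm c * (SUP i. row_sum A i)" for i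
    unfolding row_sum_scale by (intro mult_left_mono bounded_matrixD(2) assms) auto
qed

lemma bounded_matrix_uminus: "bounded_matrix A \<Longrightarrow> bounded_matrix (\<lambda>i j. - A i j)"
  using bounded_matrix_scale[of A "-1"] by simp

lemma bounded_matrix_diff:
  "bounded_matrix A \<Longrightarrow> bounded_matrix B \<Longrightarrow> bounded_matrix (\<lambda>i j. A i j - B i j)"
  using bounded_matrix_add[OF _ bounded_matrix_uminus[of B], of A] by simp

lemma bounded_matrix_entry_le:
  assumes "bounded_matrix A"
  shows "norm (A i j) \<le> (SUP i. row_sum A i)"
proof -
  have "(\<Sum>\<^sub>\<infinity>j\<in>{j}. norm (A i j)) \<le> (\<Sum>\<^sub>\<infinity>j. norm (A i j))"
    by (rule infsum_mono2) (auto intro: bounded_matrixD(1)[OF assms])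
  then show ?thesis
    using bounded_matrixD(2)[OF assms, of i] by (simp add: row_sum_def)
qed

lemma abs_summable_prod_iff:
  fixes g :: "nat \<Rightarrow> nat \<Rightarrow> complex"
  shows "(\<lambda>(k, j). g k j) abs_summable_on UNIV \<longleftrightarrow>
    (\<forall>k. g k abs_summable_on UNIV) \<and> (\<lambda>k. \<Sum>\<^sub>\<infinity>j. norm (g k j)) summable_on UNIV"
  using Infinite_Sum.abs_summable_on_Sigma_iff[where f = "\<lambda>(k, j). g k j" and A = UNIV and B = "\<lambda>_. UNIV"]
  by (simp add: infsum_nonneg)

lemma abs_summable_row_times:
  assumes f: "f abs_summable_on (UNIV :: nat set)" and B: "bounded_matrix B"
  shows "(\<lambda>(k, j). f k * B k j) abs_summable_on UNIV"
  unfolding abs_summable_prod_iff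
proof (intro conjI allI)
  fix k :: nat
  show "(\<lambda>j. f k * B k j) abs_summable_on UNIV"
    unfolding norm_mult by (intro summable_on_cmult_right bounded_matrixD(1)[OF B])
next
  have "(\<lambda>k. norm (f k) * row_sum B k) summable_on UNIV"
  proof (rule summable_on_comparison_test)
    show "(\<lambda>k. norm (f k) * (SUP i. row_sum B i)) summable_on UNIV"
      by (rule summable_on_cmult_left[OF f])
  qed (auto intro!: mult_left_mono bounded_matrixD(2)[OF B] mult_nonneg_nonneg row_sum_nonneg)
  then show "(\<lambda>k. \<Sum>\<^sub>\<infinity>j. norm (f k * B k j)) summable_on UNIV"
    by (simp add: norm_mult infsum_cmult_right' row_sum_def)
qed

lemma abs_summable_swap:
  fixes g :: "nat \<Rightarrow> nat \<Rightarrow> complex"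
  assumes "(\<lambda>(k, j). g k j) abs_summable_on UNIV"
  shows "(\<lambda>(j, k). g k j) abs_summable_on UNIV"
proof -
  have "bij_betw prod.swap (UNIV :: (nat \<times> nat) set) UNIV"
    by (rule bij_swap)
  from summable_on_reindex_bij_betw[OF this, of "\<lambda>p. norm (case p of (k, j) \<Rightarrow> g k j)"] assms
  show ?thesis by (simp add: case_prod_unfold)
qed

lemma row_times:
  assumes f: "f abs_summable_on (UNIV :: nat set)" and B: "bounded_matrix B"
  shows "(\<lambda>k. f k * B k j) abs_summable_on UNIV"
    and "(\<lambda>j. \<Sum>\<^sub>\<infinity>k. f k * B k j) abs_summable_on UNIV"
    and "(\<Sum>\<^sub>\<infinity>j. norm (\<Sum>\<^sub>\<infinity>k. f k * B k j)) \<le> (\<Sum>\<^sub>\<infinity>k. norm (f k)) * (SUP i. row_sum B i)"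
proof -
  note kj = abs_summable_row_times[OF f B]
  note jk = abs_summable_swap[OF kj]
  show *: "(\<lambda>k. f k * B k j) abs_summable_on UNIV" for j
    using jk unfolding abs_summable_prod_iff by blast
  have s: "(\<lambda>j. \<Sum>\<^sub>\<infinity>k. norm (f k * B k j)) summable_on UNIV"
    using jk unfolding abs_summable_prod_iff by blast
  show **: "(\<lambda>j. \<Sum>\<^sub>\<infinity>k. f k * B k j) abs_summable_on UNIV"
    by (rule summable_on_comparison_test[OF s]) (auto intro: norm_infsum_bound *)
  have "(\<Sum>\<^sub>\<infinity>j. norm (\<Sum>\<^sub>\<infinity>k. f k * B k j)) \<le> (\<Sum>\<^sub>\<infinity>j. \<Sum>\<^sub>\<infinity>k. norm (f k * B k j))"
    by (rule infsum_mono[OF ** s]) (rule norm_infsum_bound[OF *])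
  also have "\<dots> = (\<Sum>\<^sub>\<infinity>k. \<Sum>\<^sub>\<infinity>j. norm (f k * B k j))"
    by (rule infsum_swap_banach) (use jk in \<open>simp add: case_prod_unfold\<close>)
  also have "\<dots> = (\<Sum>\<^sub>\<infinity>k. norm (f k) * row_sum B k)"
    by (simp add: norm_mult infsum_cmult_right' row_sum_def)
  also have "\<dots> \<le> (\<Sum>\<^sub>\<infinity>k. norm (f k) * (SUP i. row_sum B i))"
  proof (rule infsum_mono)
    show s: "(\<lambda>k. norm (f k) * (SUP i. row_sum B i)) summable_on UNIV"
      by (rule summable_on_cmult_left[OF f])
    show "(\<lambda>k. norm (f k) * row_sum B k) summable_on UNIV"
      by (rule summable_on_comparison_test[OF s])
        (auto intro!: mult_left_mono bounded_matrixD(2)[OF B] mult_nonneg_nonneg row_sum_nonneg)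
  qed (auto intro!: mult_left_mono bounded_matrixD(2)[OF B])
  also have "\<dots> = (\<Sum>\<^sub>\<infinity>k. norm (f k)) * (SUP i. row_sum B i)"
    by (rule infsum_cmult_left')
  finally show "(\<Sum>\<^sub>\<infinity>j. norm (\<Sum>\<^sub>\<infinity>k. f k * B k j)) \<le> (\<Sum>\<^sub>\<infinity>k. norm (f k)) * (SUP i. row_sum B i)" .
qed

lemma row_sum_times_le:
  assumes "bounded_matrix A" "bounded_matrix B"
  shows "row_sum (\<lambda>i j. \<Sum>\<^sub>\<infinity>k. A i k * B k j) i \<le> (SUP i. row_sum A i) * (SUP i. row_sum B i)"
proof -
  have "row_sum (\<lambda>i j. \<Sum>\<^sub>\<infinity>k. A i k * B k j) i \<le> row_sum A i * (SUP i. row_sum B i)"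
    unfolding row_sum_def[of A] row_sum_def[of "\<lambda>i j. \<Sum>\<^sub>\<infinity>k. A i k * B k j"]
    by (rule row_times(3)[OF bounded_matrixD(1)[OF assms(1)] assms(2)])
  also have "\<dots> \<le> (SUP i. row_sum A i) * (SUP i. row_sum B i)"
    by (intro mult_right_mono bounded_matrixD(2)[OF assms(1)])
      (use row_sum_nonneg bounded_matrixD(2)[OF assms(2)] order_trans in blast)
  finally show ?thesis .
qed

lemma bounded_matrix_times:
  assumes "bounded_matrix A" "bounded_matrix B"
  shows "bounded_matrix (\<lambda>i j. \<Sum>\<^sub>\<infinity>k. A i k * B k j)"
  by (rule bounded_matrixI[OF row_times(2)[OF bounded_matrixD(1)[OF assms(1)] assms(2)]
        row_sum_times_le[OF assms]])

lemma matrix_times_assoc: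
  assumes A: "bounded_matrix A" and B: "bounded_matrix B" and C: "bounded_matrix C"
  shows "(\<Sum>\<^sub>\<infinity>k. (\<Sum>\<^sub>\<infinity>l. A i l * B l k) * C k j) = (\<Sum>\<^sub>\<infinity>l. A i l * (\<Sum>\<^sub>\<infinity>k. B l k * C k j))"
proof -
  have lk: "(\<lambda>(l, k). A i l * B l k) abs_summable_on UNIV"
    by (rule abs_summable_row_times[OF bounded_matrixD(1)[OF A] B])
  have "(\<lambda>(l, k). A i l * B l k * C k j) abs_summable_on UNIV"
  proof (rule summable_on_comparison_test)
    show "(\<lambda>p. norm (case p of (l, k) \<Rightarrow> A i l * B l k) * (SUP i. row_sum C i))
            summable_on UNIV"
      by (rule summable_on_cmult_left[OF lk])
  qed (auto simp: norm_mult intro!: mult_left_mono bounded_matrix_entry_le[OF C])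
  then have s: "(\<lambda>(l, k). A i l * B l k * C k j) summable_on UNIV \<times> UNIV"
    by (simp add: abs_summable_summable)
  have "(\<Sum>\<^sub>\<infinity>l. A i l * (\<Sum>\<^sub>\<infinity>k. B l k * C k j)) = (\<Sum>\<^sub>\<infinity>l. \<Sum>\<^sub>\<infinity>k. A i l * B l k * C k j)"
    by (simp add: infsum_cmult_right'[symmetric] mult.assoc)
  also have "\<dots> = (\<Sum>\<^sub>\<infinity>k. \<Sum>\<^sub>\<infinity>l. A i l * B l k * C k j)"
    by (rule infsum_swap_banach[OF s])
  also have "\<dots> = (\<Sum>\<^sub>\<infinity>k. (\<Sum>\<^sub>\<infinity>l. A i l * B l k) * C k j)"
    by (simp add: infsum_cmult_left')
  finally show ?thesis ..
qed

typedef linf_mat = "{A. bounded_matrix A}"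
  morphisms entry Abs_linf_mat
  using bounded_matrix_zero by blast

setup_lifting type_definition_linf_mat

lemma bounded_matrix_entry: "bounded_matrix (entry A)"
  using entry[of A] by simp

instantiation linf_mat :: real_normed_algebra_1
begin

lift_definition zero_linf_mat :: linf_mat is "\<lambda>i j. 0"
  by (rule bounded_matrix_zero)

lift_definition one_linf_mat :: linf_mat is "\<lambda>i j. if i = j then 1 else 0"
  by (rule bounded_matrix_one)

lift_definition plus_linf_mat :: "linf_mat \<Rightarrow> linf_mat \<Rightarrow> linf_mat" is "\<lambda>A B i j. A i j + B i j"
  by (rule bounded_matrix_add)

lift_definition uminus_linf_mat :: "linf_mat \<Rightarrow> linf_mat" is "\<lambda>A i j. - A i j"
  by (rule bounded_matrix_uminus)

lift_definition minus_linf_mat :: "linf_mat \<Rightarrow> linf_mat \<Rightarrow> linf_mat" is "\<lambda>A B i j. A i j - B i j"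
  by (rule bounded_matrix_diff)

lift_definition times_linf_mat :: "linf_mat \<Rightarrow> linf_mat \<Rightarrow> linf_mat"
  is "\<lambda>A B i j. \<Sum>\<^sub>\<infinity>k. A i k * B k j"
  by (rule bounded_matrix_times)

lift_definition scaleR_linf_mat :: "real \<Rightarrow> linf_mat \<Rightarrow> linf_mat"
  is "\<lambda>c A i j. complex_of_real c * A i j"
  by (rule bounded_matrix_scale)

lift_definition norm_linf_mat :: "linf_mat \<Rightarrow> real" is "\<lambda>A. SUP i. row_sum A i" .

definition sgn_linf_mat :: "linf_mat \<Rightarrow> linf_mat" where
  "sgn_linf_mat A = scaleR (inverse (norm A)) A"

definition dist_linf_mat :: "linf_mat \<Rightarrow> linf_mat \<Rightarrow> real" where
  "dist_linf_mat A B = norm (A - B)"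

definition uniformity_linf_mat :: "(linf_mat \<times> linf_mat) filter" where
  "uniformity_linf_mat = (INF e\<in>{0<..}. principal {(x, y). dist x y < e})"

definition open_linf_mat :: "linf_mat set \<Rightarrow> bool" where
  "open_linf_mat U \<longleftrightarrow> (\<forall>x\<in>U. eventually (\<lambda>(x', y). x' = x \<longrightarrow> y \<in> U) uniformity)"

instance
proof
  fix A B C :: linf_mat and a b :: real
  show "A + B + C = A + (B + C)" by transfer (simp add: add.assoc)
  show "A + B = B + A" by transfer (simp add: add.commute)
  show "0 + A = A" by transfer simp
  show "- A + A = 0" by transfer simp
  show "A - B = A + - B" by transfer simp
  show "A * B * C = A * (B * C)" by transfer (intro ext matrix_times_assoc)
  show "1 * A = A"
  proof transfer
    fix A :: "nat \<Rightarrow> nat \<Rightarrow> complex"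
    show "(\<lambda>i j. \<Sum>\<^sub>\<infinity>k. (if i = k then 1 else 0) * A k j) = A"
    proof (intro ext)
      fix i j show "(\<Sum>\<^sub>\<infinity>k. (if i = k then 1 else 0) * A k j) = A i j"
        by (subst infsum_delta[where i = i]) auto
    qed
  qed
  show "A * 1 = A"
  proof transfer
    fix A :: "nat \<Rightarrow> nat \<Rightarrow> complex"
    show "(\<lambda>i j. \<Sum>\<^sub>\<infinity>k. A i k * (if k = j then 1 else 0)) = A"
    proof (intro ext)
      fix i j show "(\<Sum>\<^sub>\<infinity>k. A i k * (if k = j then 1 else 0)) = A i j"
        by (subst infsum_delta[where i = j]) auto
    qed
  qed
  show "(A + B) * C = A * C + B * C"
  proof transfer
    fix A B C :: "nat \<Rightarrow> nat \<Rightarrow> complex"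
    assume A: "bounded_matrix A" and B: "bounded_matrix B" and C: "bounded_matrix C"
    have "(\<Sum>\<^sub>\<infinity>k. (A i k + B i k) * C k j) =
        (\<Sum>\<^sub>\<infinity>k. A i k * C k j) + (\<Sum>\<^sub>\<infinity>k. B i k * C k j)" for i j
      unfolding distrib_right
      by (rule infsum_add; rule abs_summable_summable, rule row_times(1), rule bounded_matrixD(1); fact)
    then show "(\<lambda>i j. \<Sum>\<^sub>\<infinity>k. (A i k + B i k) * C k j) =
        (\<lambda>i j. (\<Sum>\<^sub>\<infinity>k. A i k * C k j) + (\<Sum>\<^sub>\<infinity>k. B i k * C k j))" by simp
  qed
  show "A * (B + C) = A * B + A * C"
  proof transfer
    fix A B C :: "nat \<Rightarrow> nat \<Rightarrow> complex"
    assume A: "bounded_matrix A" and B: "bounded_matrix B" and C: "bounded_matrix C"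
    have "(\<Sum>\<^sub>\<infinity>k. A i k * (B k j + C k j)) =
        (\<Sum>\<^sub>\<infinity>k. A i k * B k j) + (\<Sum>\<^sub>\<infinity>k. A i k * C k j)" for i j
      unfolding distrib_left
      by (rule infsum_add; rule abs_summable_summable, rule row_times(1), rule bounded_matrixD(1); fact)
    then show "(\<lambda>i j. \<Sum>\<^sub>\<infinity>k. A i k * (B k j + C k j)) =
        (\<lambda>i j. (\<Sum>\<^sub>\<infinity>k. A i k * B k j) + (\<Sum>\<^sub>\<infinity>k. A i k * C k j))" by simp
  qed
  show "(0 :: linf_mat) \<noteq> 1"
    by transfer (metis zero_neq_one)
  show "a *\<^sub>R (A + B) = a *\<^sub>R A + a *\<^sub>R B" by transfer (simp add: distrib_left)
  show "(a + b) *\<^sub>R A = a *\<^sub>R A + b *\<^sub>R A" by transfer (simp add: distrib_right)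
  show "a *\<^sub>R b *\<^sub>R A = (a * b) *\<^sub>R A" by transfer (simp add: mult.assoc)
  show "1 *\<^sub>R A = A" by transfer simp
  show "a *\<^sub>R A * B = a *\<^sub>R (A * B)"
    by transfer (simp add: mult.assoc infsum_cmult_right')
  show "A * a *\<^sub>R B = a *\<^sub>R (A * B)"
  proof transfer
    fix A B :: "nat \<Rightarrow> nat \<Rightarrow> complex" and a :: real
    show "(\<lambda>i j. \<Sum>\<^sub>\<infinity>k. A i k * (complex_of_real a * B k j)) =
        (\<lambda>i j. complex_of_real a * (\<Sum>\<^sub>\<infinity>k. A i k * B k j))"
      by (simp add: mult.left_commute[of _ "complex_of_real a"] infsum_cmult_right')
  qed
  show "dist A B = norm (A - B)" by (rule dist_linf_mat_def)
  show "sgn A = scaleR (inverse (norm A)) A" by (rule sgn_linf_mat_def)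
  show "(uniformity :: (linf_mat \<times> linf_mat) filter) =
      (INF e\<in>{0<..}. principal {(x, y). dist x y < e})"
    by (rule uniformity_linf_mat_def)
  show "open U \<longleftrightarrow> (\<forall>x\<in>U. eventually (\<lambda>(x', y). x' = x \<longrightarrow> y \<in> U) uniformity)"
    for U :: "linf_mat set"
    by (rule open_linf_mat_def)
  show "norm A = 0 \<longleftrightarrow> A = 0"
  proof transfer
    fix A :: "nat \<Rightarrow> nat \<Rightarrow> complex"
    assume A: "bounded_matrix A"
    show "(SUP i. row_sum A i) = 0 \<longleftrightarrow> A = (\<lambda>i j. 0)"
    proof
      assume "(SUP i. row_sum A i) = 0"
      then have "norm (A i j) \<le> 0" for i j
        using bounded_matrix_entry_le[OF A, of i j] by simp
      then show "A = (\<lambda>i j. 0)" by auto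
    qed simp
  qed
  show "norm (A + B) \<le> norm A + norm B"
  proof transfer
    fix A B :: "nat \<Rightarrow> nat \<Rightarrow> complex"
    assume AB: "bounded_matrix A" "bounded_matrix B"
    show "(SUP i. row_sum (\<lambda>i j. A i j + B i j) i) \<le> (SUP i. row_sum A i) + (SUP i. row_sum B i)"
    proof (rule cSUP_least)
      show "row_sum (\<lambda>i j. A i j + B i j) i \<le> (SUP i. row_sum A i) + (SUP i. row_sum B i)" for i
        using row_sum_add_le(2)[OF AB, of i] bounded_matrixD(2)[OF AB(1), of i]
          bounded_matrixD(2)[OF AB(2), of i] by linarith
    qed simp
  qed
  show "norm (a *\<^sub>R A) = \<bar>a\<bar> * norm A"
  proof transfer
    fix a :: real and A :: "nat \<Rightarrow> nat \<Rightarrow> complex"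
    assume A: "bounded_matrix A"
    have "continuous (at_left (SUP i. row_sum A i)) (\<lambda>x. \<bar>a\<bar> * x)"
      by (intro continuous_intros)
    then have "(SUP i. \<bar>a\<bar> * row_sum A i) = \<bar>a\<bar> * (SUP i. row_sum A i)"
      using continuous_at_Sup_mono[of "\<lambda>x. \<bar>a\<bar> * x" "range (row_sum A)"] A
      by (simp add: bounded_matrix_def mono_def mult_left_mono image_image)
    then show "(SUP i. row_sum (\<lambda>i j. complex_of_real a * A i j) i) = \<bar>a\<bar> * (SUP i. row_sum A i)"
      by (simp add: row_sum_scale)
  qed
  show "norm (A * B) \<le> norm A * norm B"
    by transfer (intro cSUP_least row_sum_times_le; simp)
  show "norm (1 :: linf_mat) = 1"
    by transfer simp
qed

end

text \<open>
  Inverses are taken in the algebra of matrices representing bounded operators on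
  \<open>\<ell>\<^sup>\<infinity>\<close>. \<open>minv\<close> is the inverse matrix when it exists and unspecified otherwise.
\<close>

definition minvertible :: "linf_mat \<Rightarrow> bool" where
  "minvertible A \<longleftrightarrow> (\<exists>B. A * B = 1 \<and> B * A = 1)"

definition minv :: "linf_mat \<Rightarrow> linf_mat" where
  "minv A = (THE B. A * B = 1 \<and> B * A = 1)"

lemma minv_eqI:
  assumes "A * B = 1" "B * A = 1"
  shows "minv A = B"
  unfolding minv_def
proof (rule the_equality)
  fix C assume "A * C = 1 \<and> C * A = 1"
  then show "C = B" using assms by (metis mult.assoc mult_1_left mult_1_right)
qed (use assms in simp)

lift_definition cscale :: "complex \<Rightarrow> linf_mat \<Rightarrow> linf_mat" is "\<lambda>c A i j. c * A i j"
  by (rule bounded_matrix_scale)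

definition spectrum :: "linf_mat \<Rightarrow> complex set" where
  "spectrum A = {c. \<not> minvertible (cscale c 1 - A)}"

definition spectral_radius :: "linf_mat \<Rightarrow> real" where
  "spectral_radius A = (SUP c\<in>spectrum A. cmod c)"

definition nonneg_mat :: "linf_mat \<Rightarrow> bool" where
  "nonneg_mat A \<longleftrightarrow> (\<forall>i j. entry A i j \<in> \<real>\<^sub>\<ge>\<^sub>0)"

text \<open>
  An element of the Wiener algebra is represented by its family of Laurent coefficients
  \<open>(a\<^sub>i)\<close>, \<open>i \<in> \<int>\<close>, which determines it uniquely.
\<close>

definition wiener :: "(int \<Rightarrow> complex) set" where
  "wiener = {a. a abs_summable_on UNIV}"

text \<open>The matrix below is bounded, so that \<open>toeplitz a\<close> is meaningful, for \<open>a\<close> in \<open>wiener\<close>.\<close>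

definition toeplitz :: "(int \<Rightarrow> complex) \<Rightarrow> linf_mat" where
  "toeplitz a = Abs_linf_mat (\<lambda>i j. a (int j - int i))"

lemma entry_toeplitz:
  assumes "a \<in> wiener"
  shows "entry (toeplitz a) i j = a (int j - int i)"
proof -
  have a: "(\<lambda>k. norm (a k)) summable_on UNIV" using assms by (simp add: wiener_def)
  have inj: "inj (\<lambda>j. int j - int i)" for i by (simp add: inj_on_def)
  have s: "(\<lambda>k. norm (a k)) summable_on range (\<lambda>j. int j - int i)" for i
    by (rule summable_on_subset_banach[OF a]) simp
  have "bounded_matrix (\<lambda>i j. a (int j - int i))"
  proof (rule bounded_matrixI)
    fix i
    show "(\<lambda>j. a (int j - int i)) abs_summable_on UNIV"
      using s[of i] by (simp add: summable_on_reindex[OF inj] o_def)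
    have "row_sum (\<lambda>i j. a (int j - int i)) i = (\<Sum>\<^sub>\<infinity>k\<in>range (\<lambda>j. int j - int i). norm (a k))"
      by (simp add: row_sum_def infsum_reindex[OF inj] o_def)
    also have "\<dots> \<le> (\<Sum>\<^sub>\<infinity>k. norm (a k))"
      by (rule infsum_mono2[OF s a]) auto
    finally show "row_sum (\<lambda>i j. a (int j - int i)) i \<le> (\<Sum>\<^sub>\<infinity>k. norm (a k))" .
  qed
  then show ?thesis by (simp add: toeplitz_def Abs_linf_mat_inverse)
qed

definition K_d :: "linf_mat set" where
  "K_d = {E. (\<lambda>i. \<Sum>\<^sub>\<infinity>j. norm (entry E i j)) \<longlonglongrightarrow> 0}"

definition QT :: "linf_mat set" where
  "QT = {toeplitz a + E | a E. a \<in> wiener \<and> E \<in> K_d}"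

definition M_matrix :: "linf_mat \<Rightarrow> bool" where
  "M_matrix A \<longleftrightarrow>
     A \<in> QT \<and> (\<exists>\<beta> P. A = \<beta> *\<^sub>R 1 - P \<and> nonneg_mat P \<and> \<beta> \<ge> spectral_radius P)"

end

theory Submission
  imports Defs "HOL-Complex_Analysis.Cauchy_Integral_Formula"
begin

text \<open>
  Write \<open>T = T(b)\<close> and \<open>X = E\<^sub>B\<close>. The scheme doubles the pencil
  \<open>[[E\<^sub>k, 0], [-P\<^sub>k, 1]] - \<lambda> [[1, -Q\<^sub>k], [0, F\<^sub>k]]\<close>. Since \<open>\<lambda>\<^sup>2 - 2 \<lambda> + A\<^sub>1 = (\<lambda> - (2 - B)) (\<lambda> - B)\<close>, the
  initial pencil has the deflating pairs \<open>[1; X]\<close>, with induced matrix \<open>B\<close>, and \<open>[Y; 1]\<close> for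
  \<open>Y = V (1 - T V)\<^sup>-\<^sup>1\<close>, with induced matrix \<open>Z\<^sup>-\<^sup>1\<close>; each step squares these matrices, whence
  \<open>X - P\<^sub>k = (1 - P\<^sub>k Y) Z\<^sup>n X B\<^sup>n\<close> with \<open>n = 2\<^sup>k\<close>. Here \<open>\<parallel>B\<parallel> < 1\<close>, and \<open>Z\<close> is similar to \<open>V\<close> with
  \<open>\<parallel>V\<parallel> \<le> 1\<close>, so the error tends to zero, and Gelfand's bound \<open>\<parallel>M\<^sup>n\<parallel> = O(r\<^sup>n)\<close> for \<open>r > \<rho>(M)\<close>, applied
  to \<open>B\<close> and \<open>Z\<close>, gives the rate.
\<close>

section \<open>Completeness and the Neumann series\<close>

lemma sum_entry_le_norm:
  assumes "finite J"
  shows "(\<Sum>j\<in>J. norm (entry A i j)) \<le> norm A"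
proof -
  have "(\<Sum>j\<in>J. norm (entry A i j)) \<le> row_sum (entry A) i"
    unfolding row_sum_def
    by (rule finite_sum_le_infsum[OF bounded_matrixD(1)[OF bounded_matrix_entry] assms]) auto
  also have "\<dots> \<le> norm A"
    unfolding norm_linf_mat.rep_eq by (rule bounded_matrixD(2)[OF bounded_matrix_entry])
  finally show ?thesis .
qed

lemma entry_le_norm: "norm (entry A i j) \<le> norm A"
  using sum_entry_le_norm[of "{j}" A i] by simp

text \<open>Nonnegative terms with bounded finite sums are summable. Testing on finite parts of rows
  is convenient because finite sums pass to entrywise limits.\<close>

lemma bounded_matrix_finite_sums:
  assumes "\<And>i J. finite J \<Longrightarrow> (\<Sum>j\<in>J. norm (M i j)) \<le> K"
  shows "bounded_matrix M" and "row_sum M i \<le> K"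
proof -
  have s: "(\<lambda>j. norm (M i j)) summable_on UNIV" for i
    by (rule nonneg_bdd_above_summable_on) (auto intro!: bdd_aboveI2 assms)
  have r: "row_sum M i \<le> K" for i
    unfolding row_sum_def by (rule infsum_le_finite_sums[OF s]) (rule assms)
  show "bounded_matrix M" by (rule bounded_matrixI[OF s r])
  show "row_sum M i \<le> K" by (rule r)
qed

lemma norm_le_finite_sums:
  assumes "\<And>i J. finite J \<Longrightarrow> (\<Sum>j\<in>J. norm (entry A i j)) \<le> K"
  shows "norm A \<le> K"
  unfolding norm_linf_mat.rep_eq
  by (rule cSUP_least) (auto intro: bounded_matrix_finite_sums(2) assms)

lemma linf_mat_eqI: "(\<And>i j. entry A i j = entry B i j) \<Longrightarrow> A = B"
  by (metis entry_inverse ext)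

text \<open>The limit is taken entrywise. The Cauchy estimate survives on finite parts of rows,
  uniformly in the row, which gives both boundedness of \<open>L\<close> and convergence in
  norm.\<close>

instance linf_mat :: banach
proof
  fix X :: "nat \<Rightarrow> linf_mat"
  assume X: "Cauchy X"
  have "Cauchy (\<lambda>n. entry (X n) i j)" for i j
    unfolding Cauchy_def
  proof (intro allI impI)
    fix e :: real assume "e > 0"
    then obtain N where "\<And>m n. m \<ge> N \<Longrightarrow> n \<ge> N \<Longrightarrow> dist (X m) (X n) < e"
      using X unfolding Cauchy_def by blast
    moreover have "dist (entry (X m) i j) (entry (X n) i j) \<le> dist (X m) (X n)" for m n
      using entry_le_norm[of "X m - X n" i j] by (simp add: dist_norm minus_linf_mat.rep_eq)
    ultimately show "\<exists>N. \<forall>m\<ge>N. \<forall>n\<ge>N. dist (entry (X m) i j) (entry (X n) i j) < e"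
      by (meson order_le_less_trans)
  qed
  then have "\<exists>l. (\<lambda>n. entry (X n) i j) \<longlonglongrightarrow> l" for i j
    by (metis Cauchy_convergent_iff convergentD)
  then obtain L where L: "\<And>i j. (\<lambda>n. entry (X n) i j) \<longlonglongrightarrow> L i j"
    by metis
  have tail: "\<exists>N. \<forall>n\<ge>N. \<forall>i J. finite J \<longrightarrow> (\<Sum>j\<in>J. norm (entry (X n) i j - L i j)) \<le> e"
    if "e > 0" for e
  proof -
    obtain N where N: "\<And>m n. m \<ge> N \<Longrightarrow> n \<ge> N \<Longrightarrow> dist (X m) (X n) < e"
      using X \<open>e > 0\<close> unfolding Cauchy_def by blast
    have "(\<Sum>j\<in>J. norm (entry (X n) i j - L i j)) \<le> e" if n: "n \<ge> N" and J: "finite J" for n i J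
    proof (rule tendsto_upperbound)
      show "(\<lambda>m. \<Sum>j\<in>J. norm (entry (X n) i j - entry (X m) i j))
          \<longlonglongrightarrow> (\<Sum>j\<in>J. norm (entry (X n) i j - L i j))"
        by (intro tendsto_intros L)
      have "(\<Sum>j\<in>J. norm (entry (X n) i j - entry (X m) i j)) \<le> e" if "m \<ge> N" for m
        using sum_entry_le_norm[OF J, of "X n - X m" i] N[OF n that]
        by (simp add: minus_linf_mat.rep_eq dist_norm)
      then show "\<forall>\<^sub>F m in sequentially. (\<Sum>j\<in>J. norm (entry (X n) i j - entry (X m) i j)) \<le> e"
        unfolding eventually_sequentially by blast
    qed simp
    then show ?thesis by blast
  qed
  \<comment> \<open>\<open>L\<close> is bounded as the difference of \<open>X N\<close> and
    \<open>X N - L\<close>.\<close>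
  obtain N where N: "\<And>i J. finite J \<Longrightarrow> (\<Sum>j\<in>J. norm (entry (X N) i j - L i j)) \<le> 1"
    using tail[of 1] by auto
  have "bounded_matrix (\<lambda>i j. entry (X N) i j - L i j)"
    by (rule bounded_matrix_finite_sums(1)[OF N])
  from bounded_matrix_diff[OF bounded_matrix_entry[of "X N"] this] have bL: "bounded_matrix L"
    by simp
  define Y where "Y = Abs_linf_mat L"
  have Y: "entry Y = L" unfolding Y_def using bL by (simp add: Abs_linf_mat_inverse)
  have "X \<longlonglongrightarrow> Y"
    unfolding LIMSEQ_def
  proof (intro allI impI)
    fix e :: real assume "e > 0"
    then obtain N where N: "\<And>n i J. n \<ge> N \<Longrightarrow> finite J \<Longrightarrow>
        (\<Sum>j\<in>J. norm (entry (X n) i j - L i j)) \<le> e / 2"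
      using tail[of "e / 2"] by auto
    have "norm (X n - Y) \<le> e / 2" if "n \<ge> N" for n
      by (rule norm_le_finite_sums) (use N[OF that] in \<open>simp add: minus_linf_mat.rep_eq Y\<close>)
    then show "\<exists>N. \<forall>n\<ge>N. dist (X n) Y < e"
      using \<open>e > 0\<close> by (intro exI[of _ N]) (force simp: dist_norm)
  qed
  then show "convergent X" by (rule convergentI)
qed

section \<open>Complex scalars and invertibility\<close>

lemma cscale_mult_left: "cscale c A * B = cscale c (A * B)"
  by transfer (simp add: mult.assoc infsum_cmult_right')

lemma cscale_mult_right: "A * cscale c B = cscale c (A * B)"
  by transfer (simp add: mult.left_commute infsum_cmult_right')

lemma cscale_cscale: "cscale c (cscale d A) = cscale (c * d) A"
  by transfer (simp add: mult.assoc)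

lemma cscale_one [simp]: "cscale 1 A = A"
  by transfer simp

lemma cscale_zero [simp]: "cscale 0 A = 0"
  by transfer simp

lemma cscale_diff_right: "cscale c (A - B) = cscale c A - cscale c B"
  by transfer (simp add: right_diff_distrib)

lemma cscale_diff_left: "cscale (c - d) A = cscale c A - cscale d A"
  by transfer (simp add: left_diff_distrib)

lemma cscale_of_real: "cscale (complex_of_real r) A = r *\<^sub>R A"
  by transfer simp

lemma cscale_uminus_right: "cscale c (- A) = - cscale c A"
  by transfer simp

lemma cscale_power: "cscale c A ^ n = cscale (c ^ n) (A ^ n)"
  by (induction n) (simp_all add: cscale_mult_left cscale_mult_right cscale_cscale mult.commute)

text \<open>The inequality \<open>le\<close>, used a second time for \<open>1 / c\<close> and
  \<open>cscale c A\<close>, yields the reverse inequality.\<close>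

lemma norm_cscale: "norm (cscale c A) = cmod c * norm A"
proof -
  have le: "norm (cscale c A) \<le> cmod c * norm A" for c A
  proof (rule norm_le_finite_sums)
    fix i and J :: "nat set" assume "finite J"
    then show "(\<Sum>j\<in>J. norm (entry (cscale c A) i j)) \<le> cmod c * norm A"
      by (simp add: cscale.rep_eq norm_mult mult_left_mono sum_entry_le_norm flip: sum_distrib_left)
  qed
  show ?thesis
  proof (cases "c = 0")
    case False
    then have "norm A \<le> cmod (1 / c) * norm (cscale c A)"
      using le[of "1 / c" "cscale c A"] by (simp add: cscale_cscale)
    with False have "cmod c * norm A \<le> norm (cscale c A)"
      by (simp add: norm_divide field_simps)
    with le[of c A] show ?thesis by simp
  qed simp
qed

lemma minvertibleI: "A * B = 1 \<Longrightarrow> B * A = 1 \<Longrightarrow> minvertible A"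
  unfolding minvertible_def by blast

lemma minv_inverse:
  assumes "minvertible A"
  shows "A * minv A = 1" and "minv A * A = 1"
  using assms minv_eqI unfolding minvertible_def by force+

lemma minvertible_cscale:
  assumes "minvertible A" "c \<noteq> 0"
  shows "minvertible (cscale c A)"
  using minv_inverse[OF assms(1)] assms(2)
  by (intro minvertibleI[of _ "cscale (1 / c) (minv A)"])
    (simp_all add: cscale_mult_left cscale_mult_right cscale_cscale)

text \<open>Assuming summable powers instead of \<open>norm A < 1\<close> makes the Neumann series
  available when only the growth rate of the powers is controlled.\<close>

lemma minvertible_one_minus:
  assumes "summable (\<lambda>n. norm (A ^ n))"
  shows "minvertible (1 - A)" and "(\<lambda>n. A ^ n) sums minv (1 - A)"
proof -
  have s: "summable (\<lambda>n. A ^ n)" by (rule summable_norm_cancel[OF assms])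
  let ?S = "\<Sum>n. A ^ n"
  have "A * ?S = (\<Sum>n. A ^ Suc n)" "?S * A = (\<Sum>n. A ^ Suc n)"
    using suminf_mult[OF s, of A] suminf_mult2[OF s, of A] by (simp_all add: power_commutes)
  moreover have "(\<Sum>n. A ^ Suc n) = ?S - 1"
    using suminf_split_head[OF s] by simp
  ultimately have "(1 - A) * ?S = 1" "?S * (1 - A) = 1"
    by (simp_all add: algebra_simps)
  then show "minvertible (1 - A)" "(\<lambda>n. A ^ n) sums minv (1 - A)"
    using s by (auto intro: minvertibleI simp: minv_eqI summable_sums)
qed

lemma summable_norm_power:
  fixes A :: "'a :: real_normed_algebra_1"
  assumes "norm A < 1"
  shows "summable (\<lambda>n. norm (A ^ n))"
  by (rule summable_comparison_test[of _ "\<lambda>n. norm A ^ n"])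
    (use assms in \<open>auto simp: norm_power_ineq summable_geometric\<close>)

lemma minvertible_cscale_one_minus:
  assumes "norm A < cmod c"
  shows "minvertible (cscale c 1 - A)"
proof -
  have "c \<noteq> 0" using assms by (metis norm_ge_zero norm_zero not_le)
  then have "norm (cscale (1 / c) A) < 1"
    using assms by (simp add: norm_cscale norm_divide field_simps)
  then have "minvertible (cscale c (1 - cscale (1 / c) A))"
    using \<open>c \<noteq> 0\<close> by (intro minvertible_cscale minvertible_one_minus(1) summable_norm_power)
  then show ?thesis
    using \<open>c \<noteq> 0\<close> by (simp add: cscale_diff_right cscale_cscale)
qed

section \<open>The spectral radius bounds the growth of powers\<close>

text \<open>With weights of modulus at most 1 these functionals have norm at most 1 and jointly
  determine the norm, so that scalar complex analysis applies to matrix-valued functions.\<close>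

definition row_functional :: "nat \<Rightarrow> nat set \<Rightarrow> (nat \<Rightarrow> complex) \<Rightarrow> linf_mat \<Rightarrow> complex" where
  "row_functional i J u A = (\<Sum>j\<in>J. u j * entry A i j)"

lemma row_functional_cscale: "row_functional i J u (cscale c A) = c * row_functional i J u A"
  unfolding row_functional_def by (simp add: cscale.rep_eq sum_distrib_left mult_ac)

lemma row_functional_diff:
  "row_functional i J u (A - B) = row_functional i J u A - row_functional i J u B"
  unfolding row_functional_def by (simp add: minus_linf_mat.rep_eq algebra_simps sum_subtractf)

lemma norm_row_functional_le:
  assumes "finite J" "\<And>j. j \<in> J \<Longrightarrow> cmod (u j) \<le> 1"
  shows "cmod (row_functional i J u A) \<le> norm A"
proof -
  have "cmod (row_functional i J u A) \<le> (\<Sum>j\<in>J. cmod (u j * entry A i j))"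
    unfolding row_functional_def by (rule norm_sum)
  also have "\<dots> \<le> (\<Sum>j\<in>J. norm (entry A i j))"
    by (rule sum_mono) (use assms(2) in \<open>simp add: norm_mult mult_left_le_one_le\<close>)
  also have "\<dots> \<le> norm A" by (rule sum_entry_le_norm[OF assms(1)])
  finally show ?thesis .
qed

lemma bounded_linear_row_functional:
  assumes "finite J" "\<And>j. j \<in> J \<Longrightarrow> cmod (u j) \<le> 1"
  shows "bounded_linear (row_functional i J u)"
proof (rule bounded_linear_intro[where K = 1])
  show "row_functional i J u (A + B) = row_functional i J u A + row_functional i J u B" for A B
    unfolding row_functional_def by (simp add: plus_linf_mat.rep_eq algebra_simps sum.distrib)
  show "row_functional i J u (r *\<^sub>R A) = r *\<^sub>R row_functional i J u A" for r A
    using row_functional_cscale[of i J u "complex_of_real r" A]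
    by (simp add: cscale_of_real scaleR_conv_of_real)
qed (use norm_row_functional_le[OF assms] in simp)

text \<open>Unimodular weights aligned with a row turn a row functional into a partial row sum.\<close>

lemma norm_le_row_functionals:
  assumes "\<And>i J u. finite J \<Longrightarrow> (\<And>j. j \<in> J \<Longrightarrow> cmod (u j) \<le> 1) \<Longrightarrow>
    cmod (row_functional i J u A) \<le> K"
  shows "norm A \<le> K"
proof (rule norm_le_finite_sums)
  fix i and J :: "nat set" assume J: "finite J"
  define u where "u j = cnj (sgn (entry A i j))" for j
  have u: "u j * entry A i j = complex_of_real (norm (entry A i j))" for j
  proof (cases "entry A i j = 0")
    case False
    have "cnj (sgn w) * w = of_real (cmod w)" if "w \<noteq> 0" for w
      using that complex_norm_square[of w]
      by (simp add: sgn_div_norm scaleR_conv_of_real field_simps power2_eq_square)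
    with False show ?thesis by (simp add: u_def)
  qed simp
  have "cmod (row_functional i J u A) \<le> K"
    by (rule assms[OF J]) (simp add: u_def norm_sgn)
  then show "(\<Sum>j\<in>J. norm (entry A i j)) \<le> K"
    by (simp add: row_functional_def u sum_nonneg flip: of_real_sum)
qed

text \<open>The linear pencil covers both uses: \<open>X = - A\<close>, \<open>Y = - 1\<close> gives
  the resolvent of \<open>A\<close>, and \<open>X = 1\<close>, \<open>Y = A\<close> gives the
  generating function of its powers.\<close>

lemma resolvent_identity:
  assumes "minvertible (X - cscale z Y)" "minvertible (X - cscale w Y)"
  shows "minv (X - cscale z Y) - minv (X - cscale w Y)
    = cscale (z - w) (minv (X - cscale z Y) * Y * minv (X - cscale w Y))"
proof -
  let ?G = "\<lambda>z. minv (X - cscale z Y)"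
  have "?G z - ?G w = ?G z * ((X - cscale w Y) * ?G w) - (?G z * (X - cscale z Y)) * ?G w"
    using minv_inverse[OF assms(1)] minv_inverse[OF assms(2)] by simp
  also have "\<dots> = ?G z * (cscale (z - w) Y) * ?G w"
    by (simp add: cscale_diff_left algebra_simps)
  finally show ?thesis by (simp add: cscale_mult_left cscale_mult_right mult.assoc)
qed

text \<open>The resolvent identity bounds the difference in terms of \<open>norm (?G z)\<close>
  itself. Near \<open>w\<close> that term can be absorbed, which gives
  \<open>norm (?G z) \<le> 2 * norm (?G w)\<close> and then a Lipschitz estimate.\<close>

lemma tendsto_resolvent:
  assumes inv: "\<And>z. z \<in> D \<Longrightarrow> minvertible (X - cscale z Y)" and "w \<in> D"
  shows "((\<lambda>z. minv (X - cscale z Y)) \<longlongrightarrow> minv (X - cscale w Y)) (at w within D)"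
proof -
  let ?G = "\<lambda>z. minv (X - cscale z Y)"
  define k where "k = norm Y * norm (?G w)"
  have k: "k \<ge> 0" by (simp add: k_def)
  have diff: "norm (?G z - ?G w) \<le> cmod (z - w) * (norm (?G z) * k)" if "z \<in> D" for z
  proof -
    have "norm (?G z - ?G w) = cmod (z - w) * norm (?G z * Y * ?G w)"
      using resolvent_identity[OF inv[OF that] inv[OF \<open>w \<in> D\<close>]] by (simp add: norm_cscale)
    also have "norm (?G z * Y * ?G w) \<le> norm (?G z) * k"
      using norm_mult_ineq[of "?G z * Y" "?G w"]
        mult_right_mono[OF norm_mult_ineq[of "?G z" Y] norm_ge_zero[of "?G w"]]
      by (simp add: k_def mult.assoc)
    finally show ?thesis by (simp add: mult_left_mono)
  qed
  \<comment> \<open>The radius ensures \<open>cmod (z - w) * k \<le> 1 / 2\<close>; the summand 1 in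
    \<open>k + 1\<close> covers \<open>k = 0\<close>.\<close>
  have "norm (?G z - ?G w) \<le> cmod (z - w) * (2 * norm (?G w) * k)"
    if z: "z \<in> D" "dist z w < 1 / (2 * (k + 1))" for z
  proof -
    have "cmod (z - w) * (k + 1) \<le> 1 / 2"
      using z(2) k by (simp add: dist_norm field_simps)
    then have "cmod (z - w) * k \<le> 1 / 2"
      by (simp add: distrib_left) (smt (verit) norm_ge_zero)
    then have "norm (?G z) * (cmod (z - w) * k) \<le> norm (?G z) * (1 / 2)"
      by (rule mult_left_mono) simp
    then have "norm (?G z - ?G w) \<le> norm (?G z) / 2"
      using diff[OF z(1)] by (simp add: mult_ac)
    then have "norm (?G z) \<le> 2 * norm (?G w)"
      using norm_triangle_ineq2[of "?G z" "?G w"] by linarith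
    then have "norm (?G z) * k \<le> 2 * norm (?G w) * k"
      by (rule mult_right_mono[OF _ k])
    then show ?thesis
      using diff[OF z(1)] by (meson mult_left_mono norm_ge_zero order_trans)
  qed
  then have "\<forall>\<^sub>F z in at w within D.
      norm (?G z - ?G w) \<le> cmod (z - w) * (2 * norm (?G w) * k)"
    unfolding eventually_at
  proof (intro exI[of _ "1 / (2 * (k + 1))"] conjI ballI impI)
    show "0 < 1 / (2 * (k + 1))" using add_nonneg_pos[OF k zero_less_one] by simp
  qed auto
  moreover have "((\<lambda>z. cmod (z - w) * (2 * norm (?G w) * k)) \<longlongrightarrow> 0) (at w within D)"
    by (rule tendsto_eq_intros refl | simp)+
  ultimately have "((\<lambda>z. ?G z - ?G w) \<longlongrightarrow> 0) (at w within D)"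
    by (rule Lim_null_comparison)
  then show ?thesis by (rule Lim_null[THEN iffD2])
qed

text \<open>By the resolvent identity the difference quotient is exactly the functional at
  \<open>?G z * Y * ?G w\<close>, so continuity of the resolvent suffices.\<close>

lemma has_field_derivative_row_functional_resolvent:
  assumes "\<And>z. z \<in> D \<Longrightarrow> minvertible (X - cscale z Y)" and "w \<in> D"
    and "finite J" "\<And>j. j \<in> J \<Longrightarrow> cmod (u j) \<le> 1"
  shows "((\<lambda>z. row_functional i J u (minv (X - cscale z Y))) has_field_derivative
    row_functional i J u (minv (X - cscale w Y) * Y * minv (X - cscale w Y))) (at w within D)"
proof -
  let ?G = "\<lambda>z. minv (X - cscale z Y)"
  have "((\<lambda>z. row_functional i J u (?G z * Y * ?G w)) \<longlongrightarrow>
      row_functional i J u (?G w * Y * ?G w)) (at w within D)"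
    by (intro bounded_linear.tendsto[OF bounded_linear_row_functional] tendsto_intros
        tendsto_resolvent assms)
  moreover have "\<forall>\<^sub>F z in at w within D. row_functional i J u (?G z * Y * ?G w) =
      (row_functional i J u (?G z) - row_functional i J u (?G w)) / (z - w)"
    unfolding eventually_at
  proof (intro exI[of _ 1] conjI ballI impI)
    fix z assume "z \<in> D" and "z \<noteq> w \<and> dist z w < 1"
    then show "row_functional i J u (?G z * Y * ?G w) =
      (row_functional i J u (?G z) - row_functional i J u (?G w)) / (z - w)"
      by (simp flip: row_functional_diff
          add: resolvent_identity assms(1) \<open>w \<in> D\<close> row_functional_cscale)
  qed simp
  ultimately show ?thesis
    unfolding has_field_derivative_iff by (rule Lim_transform_eventually)
qed

section \<open>The spectrum and the spectral radius\<close>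

lemma norm_le_of_mem_spectrum:
  assumes "c \<in> spectrum A"
  shows "cmod c \<le> norm A"
  using assms minvertible_cscale_one_minus[of A c] by (auto simp: spectrum_def not_less[symmetric])

lemma cmod_le_spectral_radius:
  assumes "c \<in> spectrum A"
  shows "cmod c \<le> spectral_radius A"
  unfolding spectral_radius_def
  by (rule cSUP_upper[OF assms]) (auto intro!: bdd_aboveI2 norm_le_of_mem_spectrum)

text \<open>With empty spectrum the resolvent would be entire and vanish at infinity. Liouville's
  theorem, entry by entry, would make it zero at the origin, where it is an inverse.\<close>

lemma spectrum_nonempty: "spectrum A \<noteq> {}"
proof
  assume "spectrum A = {}"
  then have inv': "minvertible (cscale z 1 - A)" for z
    unfolding spectrum_def by blast
  then have inv: "minvertible (- A - cscale z (- 1))" for z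
    by (simp add: cscale_uminus_right)
  let ?H = "\<lambda>z. minv (cscale z 1 - A)"
  have H: "?H z = minv (- A - cscale z (- 1))" for z
    by (simp add: cscale_uminus_right)
  have decay: "norm (?H z) \<le> 1 / (cmod z - norm A)" if "cmod z > norm A" for z
  proof -
    have "cscale z (?H z) = 1 + A * ?H z"
      using minv_inverse(1)[OF inv'[of z]] by (simp add: left_diff_distrib cscale_mult_left algebra_simps)
    then have "cmod z * norm (?H z) = norm (1 + A * ?H z)"
      by (simp flip: norm_cscale)
    also have "\<dots> \<le> 1 + norm A * norm (?H z)"
      by (rule norm_triangle_le) (simp add: norm_mult_ineq)
    finally have "cmod z * norm (?H z) \<le> 1 + norm A * norm (?H z)" .
    then show ?thesis using that by (simp add: field_simps)
  qed
  have "entry (?H 0) i j = 0" for i j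
  proof -
    let ?f = "row_functional i {j} (\<lambda>_. 1)"
    have "(\<lambda>z. ?f (?H z)) holomorphic_on UNIV"
      unfolding H holomorphic_on_def field_differentiable_def
    proof (intro ballI exI)
      show "((\<lambda>z. ?f (minv (- A - cscale z (- 1)))) has_field_derivative
        ?f (minv (- A - cscale w (- 1)) * (- 1) * minv (- A - cscale w (- 1)))) (at w)" for w
        by (rule has_field_derivative_row_functional_resolvent) (simp_all add: inv)
    qed
    moreover have "((\<lambda>z. ?f (?H z)) \<longlongrightarrow> 0) at_infinity"
    proof (rule Lim_null_comparison)
      show "\<forall>\<^sub>F z in at_infinity. norm (?f (?H z)) \<le> 1 / (cmod z - norm A)"
        unfolding eventually_at_infinity
      proof (intro exI allI impI)
        fix z assume "norm A + 1 \<le> cmod z"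
        then show "norm (?f (?H z)) \<le> 1 / (cmod z - norm A)"
          using norm_row_functional_le[of "{j}" "\<lambda>_. 1" i "?H z"] decay[of z] by simp
      qed
      have "filterlim (\<lambda>z. - norm A + cmod z) at_top at_infinity"
        by (rule filterlim_tendsto_add_at_top[OF tendsto_const filterlim_norm_at_top])
      then have "filterlim (\<lambda>z::complex. cmod z - norm A) at_infinity at_infinity"
        by (simp add: filterlim_at_top_imp_at_infinity)
      then show "((\<lambda>z::complex. 1 / (cmod z - norm A)) \<longlongrightarrow> 0) at_infinity"
        by (rule tendsto_divide_0[OF tendsto_const])
    qed
    ultimately have "?f (?H 0) = 0" by (rule Liouville_weak)
    then show ?thesis by (simp add: row_functional_def)
  qed
  then have "?H 0 = 0" by (intro linf_mat_eqI) (simp add: zero_linf_mat.rep_eq)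
  then show False using minv_inverse(1)[OF inv'[of 0]] by simp
qed

lemma spectral_radius_nonneg: "spectral_radius A \<ge> 0"
proof -
  obtain c where "c \<in> spectrum A" using spectrum_nonempty by blast
  then show ?thesis
    using cmod_le_spectral_radius[of c A] norm_ge_zero[of c] by linarith
qed

text \<open>
  The quantitative half of Gelfand's formula: Cauchy's inequality, applied to the row functionals of
  \<open>z \<mapsto> (1 - z A)\<^sup>-\<^sup>1\<close> on the disc of radius \<open>1 / r\<close>, bounds all of them by the same constant.
\<close>

theorem power_bound:
  assumes r: "r > spectral_radius A"
  obtains M where "M > 0" and "\<And>n. norm (A ^ n) \<le> M * r ^ n"
proof -
  have r0: "r > 0" using r spectral_radius_nonneg[of A] by linarith
  define D where "D = cball (0::complex) (1 / r)"
  let ?G = "\<lambda>z. minv (1 - cscale z A)"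
  \<comment> \<open>For \<open>z \<noteq> 0\<close> the matrix is \<open>z\<close> times the pencil
    at \<open>1 / z\<close>, whose modulus is at least \<open>r\<close> and hence outside the
    spectrum.\<close>
  have inv: "minvertible (1 - cscale z A)" if "z \<in> D" for z
  proof (cases "z = 0")
    case False
    then have "cmod (1 / z) \<ge> r" using that r0 by (simp add: D_def norm_divide field_simps)
    then have "1 / z \<notin> spectrum A" using r cmod_le_spectral_radius[of "1 / z" A] by auto
    then have "minvertible (cscale z (cscale (1 / z) 1 - A))"
      using False by (intro minvertible_cscale) (auto simp: spectrum_def)
    then show ?thesis using False by (simp add: cscale_diff_right cscale_cscale)
  qed (auto intro: minvertibleI[of 1 1])
  have "continuous_on D ?G"
    unfolding continuous_on_def using tendsto_resolvent[of D 1 A] inv by blast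
  then have "bounded (?G ` D)"
    by (intro compact_imp_bounded compact_continuous_image) (auto simp: D_def)
  then obtain M where "M > 0" and M: "\<And>z. z \<in> D \<Longrightarrow> norm (?G z) \<le> M"
    unfolding bounded_pos by auto
  have "norm (A ^ n) \<le> M * r ^ n" for n
  proof (rule norm_le_row_functionals)
    fix i u and J :: "nat set"
    assume J: "finite J" and u: "\<And>j. j \<in> J \<Longrightarrow> cmod (u j) \<le> 1"
    let ?\<phi> = "row_functional i J u"
    have lin: "bounded_linear ?\<phi>"
      by (rule bounded_linear_row_functional[OF J]) (rule u)
    define f where "f z = ?\<phi> (?G z)" for z
    have df: "(f has_field_derivative ?\<phi> (?G w * A * ?G w)) (at w within D)" if "w \<in> D" for w
      unfolding f_def
      by (rule has_field_derivative_row_functional_resolvent[OF inv that J u])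
    then have "continuous_on D f" by (rule DERIV_continuous_on)
    moreover have "f holomorphic_on D"
      using df by (auto simp: holomorphic_on_def field_differentiable_def)
    then have "f holomorphic_on ball 0 (1 / r)"
      by (rule holomorphic_on_subset) (auto simp: D_def)
    moreover have "norm (f z) \<le> M" if "norm (0 - z) = 1 / r" for z
      unfolding f_def
      by (rule order_trans[OF norm_row_functional_le[OF J u] M]) (use that in \<open>auto simp: D_def\<close>)
    ultimately have "norm ((deriv ^^ n) f 0) \<le> fact n * M / (1 / r) ^ n"
      using r0 by (intro Cauchy_inequality) (auto simp: D_def)
    \<comment> \<open>The Neumann series near 0 identifies the derivatives there; the Cauchy
      estimate uses the disc of radius \<open>1 / r\<close>, on which that series is not
      invoked.\<close>
    moreover have "f has_fps_expansion Abs_fps (\<lambda>n. ?\<phi> (A ^ n))"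
    proof (rule has_fps_expansionI)
      have "(\<lambda>n. ?\<phi> (A ^ n) * z ^ n) sums f z" if z: "dist z 0 < 1 / (norm A + 1)" for z
      proof -
        have "cmod z * (norm A + 1) < 1"
          using z by (simp add: field_simps add_pos_nonneg)
        then have "norm (cscale z A) < 1"
          by (simp add: norm_cscale distrib_left) (smt (verit) norm_ge_zero)
        then have "(\<lambda>n. cscale z A ^ n) sums ?G z"
          by (intro minvertible_one_minus(2) summable_norm_power)
        then have "(\<lambda>n. ?\<phi> (cscale z A ^ n)) sums f z"
          unfolding f_def by (rule bounded_linear.sums[OF lin])
        then show ?thesis
          by (simp add: cscale_power row_functional_cscale mult.commute)
      qed
      then show "\<forall>\<^sub>F z in nhds 0. (\<lambda>n. fps_nth (Abs_fps (\<lambda>n. ?\<phi> (A ^ n))) n * z ^ n) sums f z"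
        unfolding eventually_nhds_metric
        by (intro exI[of _ "1 / (norm A + 1)"]) (auto simp: add_nonneg_pos)
    qed
    then have "(deriv ^^ n) f 0 = fact n * ?\<phi> (A ^ n)"
      using fps_nth_fps_expansion[of f "Abs_fps (\<lambda>n. ?\<phi> (A ^ n))" n] by (simp add: field_simps)
    ultimately show "cmod (?\<phi> (A ^ n)) \<le> M * r ^ n"
      using r0 by (simp add: norm_mult power_one_over field_simps)
  qed
  with \<open>M > 0\<close> that show ?thesis by blast
qed

section \<open>Norm bounds for \<open>B\<close> and its Toeplitz part\<close>

lemma entry_add: "entry (A + B) i j = entry A i j + entry B i j"
  by (rule plus_linf_mat.rep_eq[THEN fun_cong, THEN fun_cong])

text \<open>Moving far down a diagonal makes the correction part disappear.\<close>

lemma norm_toeplitz_le: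
  assumes a: "a \<in> wiener" and E: "E \<in> K_d"
  shows "norm (toeplitz a) \<le> norm (toeplitz a + E)"
proof (rule norm_le_finite_sums)
  fix i and J :: "nat set" assume J: "finite J"
  let ?B = "toeplitz a + E"
  have bound: "(\<Sum>j\<in>J. norm (entry (toeplitz a) i j)) \<le> norm ?B + row_sum (entry E) (n + i)" for n
  proof -
    have inj: "inj_on ((+) n) J" by simp
    have "entry (toeplitz a) i j = entry ?B (n + i) (n + j) - entry E (n + i) (n + j)" for j
      by (simp add: entry_add entry_toeplitz[OF a])
    then have "(\<Sum>j\<in>J. norm (entry (toeplitz a) i j)) \<le>
        (\<Sum>j\<in>J. norm (entry ?B (n + i) (n + j)) + norm (entry E (n + i) (n + j)))"
      by (intro sum_mono) (simp only: norm_triangle_ineq4)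
    also have "\<dots> = (\<Sum>j\<in>(+) n ` J. norm (entry ?B (n + i) j)) +
        (\<Sum>j\<in>(+) n ` J. norm (entry E (n + i) j))"
      by (simp add: sum.distrib sum.reindex[OF inj])
    also have "\<dots> \<le> norm ?B + row_sum (entry E) (n + i)"
      unfolding row_sum_def
      by (intro add_mono sum_entry_le_norm finite_sum_le_infsum finite_imageI J
          bounded_matrixD(1)[OF bounded_matrix_entry]) auto
    finally show ?thesis .
  qed
  have "row_sum (entry E) \<longlonglongrightarrow> 0"
    using E unfolding K_d_def row_sum_def by simp
  then have "(\<lambda>n. norm ?B + row_sum (entry E) (n + i)) \<longlonglongrightarrow> norm ?B + 0"
    by (intro tendsto_add tendsto_const LIMSEQ_ignore_initial_segment)
  then show "(\<Sum>j\<in>J. norm (entry (toeplitz a) i j)) \<le> norm ?B"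
    using LIMSEQ_le_const[of _ "norm ?B + 0" "\<Sum>j\<in>J. norm (entry (toeplitz a) i j)"] bound
    by auto
qed

text \<open>The powers of \<open>A / c\<close> are dominated by \<open>M * (r / c) ^ n\<close>, so
  the Neumann series converges even if \<open>norm A\<close> exceeds \<open>c\<close>.\<close>

lemma minvertible_scaleR_one_minus:
  assumes "c > 0" "M > 0" "0 \<le> r" "r < c" and bound: "\<And>n. norm (A ^ n) \<le> M * r ^ n"
  shows "minvertible (c *\<^sub>R 1 - A)"
proof -
  let ?A = "cscale (1 / complex_of_real c) A"
  have c: "complex_of_real c \<noteq> 0" using \<open>c > 0\<close> by simp
  have le: "norm (?A ^ n) \<le> M * (r / c) ^ n" for n
  proof -
    have "norm (?A ^ n) = norm (A ^ n) / c ^ n"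
      using \<open>c > 0\<close> by (simp add: cscale_power norm_cscale norm_power norm_divide power_one_over)
    also have "\<dots> \<le> M * r ^ n / c ^ n"
      using \<open>c > 0\<close> by (intro divide_right_mono bound) simp
    finally show ?thesis by (simp add: power_divide)
  qed
  have "summable (\<lambda>n. M * (r / c) ^ n)"
    using \<open>0 \<le> r\<close> \<open>r < c\<close> by (intro summable_mult summable_geometric) simp
  then have "summable (\<lambda>n. norm (?A ^ n))"
    by (rule summable_comparison_test'[of _ 0]) (simp only: real_norm_def abs_norm_cancel le)
  then have "minvertible (cscale (complex_of_real c) (1 - ?A))"
    by (intro minvertible_cscale minvertible_one_minus(1) c)
  then show ?thesis
    using c by (simp add: cscale_diff_right cscale_cscale cscale_of_real del: of_real_eq_0_iff)
qed

lemma minvertible_two_minus: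
  assumes "norm A < 2"
  shows "minvertible (2 - A)"
proof -
  have "minvertible (2 *\<^sub>R 1 - A)"
    by (rule minvertible_scaleR_one_minus[of 2 1 "norm A"]) (use assms norm_power_ineq in auto)
  then show ?thesis by (simp add: scaleR_2)
qed

text \<open>This transfers a growth rate \<open>r\<close> of \<open>P\<close> to the rate
  \<open>r + q\<close> of \<open>P + C\<close>. The extra factor \<open>P ^ k\<close> strengthens
  the induction: splitting off one factor \<open>P + C\<close> either raises \<open>k\<close> or
  produces a factor \<open>C\<close>.\<close>

lemma power_add_commuting_bound:
  fixes P C :: "'a :: real_normed_algebra_1"
  assumes comm: "P * C = C * P" and "norm C \<le> q" and "M > 0" "r > 0"
    and P: "\<And>n. norm (P ^ n) \<le> M * r ^ n"
  shows "norm ((P + C) ^ n * P ^ k) \<le> M * r ^ k * (r + q) ^ n"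
proof (induction n arbitrary: k)
  case 0
  then show ?case using P by simp
next
  case (Suc n)
  have q: "q \<ge> 0" using \<open>norm C \<le> q\<close> norm_ge_zero[of C] by linarith
  have "C * (P + C) = (P + C) * C" by (simp add: distrib_left distrib_right comm)
  then have "C * (P + C) ^ n = (P + C) ^ n * C" by (metis power_commuting_commutes)
  moreover have "(P + C) ^ Suc n = (P + C) ^ n * P + (P + C) ^ n * C"
    by (simp only: power_Suc2 distrib_left)
  ultimately have "(P + C) ^ Suc n * P ^ k = (P + C) ^ n * P ^ Suc k + C * ((P + C) ^ n * P ^ k)"
    by (simp add: distrib_right mult.assoc del: power_Suc) (simp flip: mult.assoc)
  then have "norm ((P + C) ^ Suc n * P ^ k)
      \<le> norm ((P + C) ^ n * P ^ Suc k) + norm C * norm ((P + C) ^ n * P ^ k)"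
    by (simp only:) (intro norm_triangle_le add_left_mono norm_mult_ineq)
  also have "\<dots> \<le> M * r ^ Suc k * (r + q) ^ n + q * (M * r ^ k * (r + q) ^ n)"
    by (intro add_mono mult_mono Suc.IH \<open>norm C \<le> q\<close> q norm_ge_zero)
  also have "\<dots> = M * r ^ k * (r + q) ^ Suc n" by (simp add: algebra_simps)
  finally show ?case .
qed

text \<open>The equation for the root says that \<open>X\<close> is a fixed point of
  \<open>f\<close>. Banach's theorem is applied inside the commutant of \<open>B\<close>, a closed
  set that \<open>f\<close> preserves, so the root commutes with \<open>B\<close>.\<close>

lemma contractive_root_exists:
  fixes A B :: "'a :: {real_normed_algebra_1, banach}"
  assumes "norm A < 1" and comm: "A * B = B * A"
  obtains X where "(1 - X)\<^sup>2 = 1 - A" "norm X < 1" "X * B = B * X"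
proof -
  \<comment> \<open>The smaller root of \<open>q\<^sup>2 - 2 * q + norm A = 0\<close>:
    \<open>f\<close> maps the ball of radius \<open>q\<close> into itself, and \<open>q\<close> is
    also its Lipschitz constant there.\<close>
  define q where "q = 1 - sqrt (1 - norm A)"
  have q: "0 \<le> q" "q < 1" using assms(1) by (simp_all add: q_def)
  have q2: "norm A + q\<^sup>2 = 2 * q"
    using assms(1) by (simp add: q_def power2_diff)
  define f where "f X = (1 / 2) *\<^sub>R (A + X\<^sup>2)" for X
  let ?S = "{X. norm X \<le> q} \<inter> {X. X * B = B * X}"
  have "\<exists>!X\<in>?S. f X = X"
  proof (rule Banach_fix[OF _ _ q])
    have "closed {X :: 'a. norm X \<le> q}" "closed {X. X * B = B * X}"
      by (intro closed_Collect_le closed_Collect_eq continuous_intros)+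
    then show "complete ?S" by (simp add: complete_eq_closed closed_Int)
    have "0 \<in> ?S" using q by simp
    then show "?S \<noteq> {}" by blast
    show "f ` ?S \<subseteq> ?S"
    proof safe
      fix X assume X: "norm X \<le> q" "X * B = B * X"
      have "norm (A + X\<^sup>2) \<le> norm A + norm X ^ 2"
        using norm_triangle_ineq[of A "X\<^sup>2"] norm_power_ineq[of X 2] by linarith
      also have "\<dots> \<le> norm A + q\<^sup>2"
        using X by (simp add: power_mono)
      finally show "norm (f X) \<le> q" using q2 by (simp add: f_def)
      have "X\<^sup>2 * B = B * X\<^sup>2"
        using X(2) by (simp add: power2_eq_square mult.assoc) (simp flip: mult.assoc)
      then show "f X * B = B * f X" by (simp add: f_def distrib_left distrib_right comm)
    qed
    fix X Y assume X: "X \<in> ?S" and Y: "Y \<in> ?S"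
    have "f X - f Y = (1 / 2) *\<^sub>R (X * (X - Y) + (X - Y) * Y)"
      by (simp add: f_def power2_eq_square algebra_simps)
    then have "norm (f X - f Y) \<le> (norm (X * (X - Y)) + norm ((X - Y) * Y)) / 2"
      by (simp add: norm_triangle_ineq)
    also have "\<dots> \<le> (norm X * norm (X - Y) + norm (X - Y) * norm Y) / 2"
      by (simp add: add_mono norm_mult_ineq)
    also have "\<dots> \<le> (q * norm (X - Y) + norm (X - Y) * q) / 2"
      using X Y q by (intro divide_right_mono add_mono mult_mono) auto
    finally show "dist (f X) (f Y) \<le> q * dist X Y" by (simp add: dist_norm)
  qed
  then obtain X where X: "norm X \<le> q" "X * B = B * X" "f X = X" by blast
  have "A + X\<^sup>2 = 2 *\<^sub>R f X" by (simp add: f_def)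
  then have "(1 - X)\<^sup>2 = 1 - A"
    using X(3) by (simp add: power2_eq_square algebra_simps scaleR_2)
  with X q that show ?thesis by force
qed

text \<open>
  Two commuting square roots \<open>1 - B\<close> and \<open>1 - X\<close> of the same matrix satisfy
  \<open>(X - B) (2 - B - X) = 0\<close>. As \<open>2 - B - X = (\<beta> + 1) - (P + X)\<close> with \<open>P\<close> and \<open>X\<close> commuting,
  \<open>\<rho>(P) \<le> \<beta>\<close> and \<open>\<parallel>X\<parallel> < 1\<close>, the second factor is invertible.
\<close>

lemma norm_lt_one_of_M_matrix_root:
  assumes M: "M_matrix (1 - B)" and root: "(1 - B)\<^sup>2 = 1 - A" and A: "norm A < 1"
  shows "norm B < 1"
proof -
  have A_eq: "A = B + B - B * B"
    using root by (simp add: power2_eq_square algebra_simps)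
  have "A * B = B * A" by (simp add: A_eq algebra_simps)
  then obtain X where X: "(1 - X)\<^sup>2 = 1 - A" "norm X < 1" "X * B = B * X"
    using contractive_root_exists A by metis
  obtain \<beta> P where P: "1 - B = \<beta> *\<^sub>R 1 - P" "\<beta> \<ge> spectral_radius P"
    using M unfolding M_matrix_def by blast
  have P_eq: "P = (\<beta> - 1) *\<^sub>R 1 + B"
    using P(1) by (simp add: algebra_simps)
  have \<beta>: "\<beta> \<ge> 0" using P(2) spectral_radius_nonneg[of P] by linarith
  \<comment> \<open>Half of the gap \<open>1 - norm X\<close> puts \<open>r\<close> strictly above
    the spectral radius of \<open>P\<close>, the other half keeps \<open>r + norm X\<close> below
    \<open>\<beta> + 1\<close>.\<close>
  define r where "r = \<beta> + (1 - norm X) / 2"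
  have r: "r > 0" "r > spectral_radius P" "r + norm X < \<beta> + 1"
    using X(2) \<beta> P(2) by (auto simp: r_def field_simps)
  obtain M where M: "M > 0" "\<And>n. norm (P ^ n) \<le> M * r ^ n"
    using power_bound[OF r(2)] by blast
  have "norm ((P + X) ^ n) \<le> M * (r + norm X) ^ n" for n
    using power_add_commuting_bound[of P X "norm X" M r n 0] M r X(3)
    by (simp add: P_eq algebra_simps)
  then have "minvertible ((\<beta> + 1) *\<^sub>R 1 - (P + X))"
    using M r \<beta> by (intro minvertible_scaleR_one_minus[of _ M "r + norm X"]) auto
  moreover have "(\<beta> + 1) *\<^sub>R 1 - (P + X) = 2 - B - X"
    by (simp add: P_eq algebra_simps)
  ultimately have inv: "minvertible (2 - B - X)" by simp
  have "(X - B) * (2 - B - X) = (1 - B)\<^sup>2 - (1 - X)\<^sup>2"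
    by (simp add: power2_eq_square algebra_simps X(3) mult_2 mult_2_right)
  then have "(X - B) * (2 - B - X) = 0" using root X(1) by simp
  then have "(X - B) * ((2 - B - X) * minv (2 - B - X)) = 0"
    by (simp flip: mult.assoc)
  then have "X = B" using minv_inverse(1)[OF inv] by simp
  with X(2) show ?thesis by simp
qed

section \<open>Doubling\<close>

text \<open>
  The premises say that \<open>[1; X]\<close> and \<open>[Y; 1]\<close> are deflating for the pencil
  \<open>[[e, 0], [-p, 1]] - \<lambda> [[1, -q], [0, f]]\<close>, with induced matrix \<open>D\<close>
  and inverse induced matrix \<open>W\<close>.
\<close>

lemma doubling_step:
  fixes e p f q X Y D W n n' :: "'a :: ring_1"
  assumes e: "e = (1 - q * X) * D" and p: "X - p = f * X * D"
    and eY: "e * Y * W = Y - q" and pY: "(1 - p * Y) * W = f"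
    and n: "n * (1 - p * q) = 1" and n': "n' * (1 - q * p) = 1"
  shows "e * n' * e = (1 - (q + e * n' * q * f) * X) * (D * D)"
    and "X - (p + f * n * p * e) = f * n * f * X * (D * D)"
    and "e * n' * e * Y * (W * W) = Y - (q + e * n' * q * f)"
    and "(1 - (p + f * n * p * e) * Y) * (W * W) = f * n * f"
proof -
  \<comment> \<open>All four conclusions follow one pattern: apply \<open>1 - q * p\<close> or
    \<open>1 - p * q\<close> to \<open>D\<close>, \<open>X * D\<close>, \<open>Y * W\<close> and
    \<open>W\<close> respectively, rewrite by the premises, cancel with \<open>n'\<close> or
    \<open>n\<close>, and multiply by \<open>e\<close> or \<open>f\<close> from the left.\<close>
  have cancel: "n * (1 - p * q) * z = z" "n' * (1 - q * p) * z = z" for z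
    by (simp_all add: n n')
  have fXD: "f * X * D = X - p" using p by simp
  have "(1 - q * p) * D = e + q * (f * X * D) * D"
    unfolding fXD e by (simp add: algebra_simps)
  then have "n' * (1 - q * p) * D = n' * (e + q * (f * X * D) * D)"
    by (simp only: mult.assoc)
  then have "n' * e + n' * (q * (f * X * D) * D) = D"
    by (simp only: cancel distrib_left)
  then have "n' * e = D - n' * (q * (f * X * D) * D)"
    by (simp only: eq_diff_eq)
  then have "e * (n' * e) = e * D - e * (n' * (q * (f * X * D) * D))"
    by (simp add: right_diff_distrib)
  moreover have "e * D = (1 - q * X) * (D * D)" by (simp add: e mult.assoc)
  ultimately show "e * n' * e = (1 - (q + e * n' * q * f) * X) * (D * D)"
    by (simp add: algebra_simps)
  have "(1 - p * q) * (X * D) = p * e + f * X * D * D"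
    unfolding fXD e by (simp add: algebra_simps)
  then have "n * (1 - p * q) * (X * D) = n * (p * e + f * X * D * D)"
    by (simp only: mult.assoc)
  then have "X * D = n * (p * e) + n * (f * X * D * D)"
    by (simp add: cancel distrib_left)
  then have "f * (X * D) = f * (n * (p * e)) + f * (n * (f * X * D * D))"
    by (simp flip: distrib_left)
  then show "X - (p + f * n * p * e) = f * n * f * X * (D * D)"
    using p by (simp add: algebra_simps)
  have qf: "q * f = q * W - q * p * Y * W" and pf: "f = W - p * Y * W"
    by (simp_all add: algebra_simps flip: pY)
  have "(1 - q * p) * (Y * W) = (Y - q) * W + q * f"
    by (simp add: qf algebra_simps)
  then have "n' * (1 - q * p) * (Y * W) = n' * ((Y - q) * W + q * f)"
    by (simp only: mult.assoc)
  then have "Y * W = n' * (e * Y * W * W) + n' * (q * f)"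
    by (simp add: cancel distrib_left eY)
  then have "e * (Y * W) = e * (n' * (e * Y * W * W)) + e * (n' * (q * f))"
    by (simp flip: distrib_left)
  then show "e * n' * e * Y * (W * W) = Y - (q + e * n' * q * f)"
    using eY by (simp add: algebra_simps)
  have "(1 - p * q) * W = p * (Y - q) * W + f"
    by (simp add: pf algebra_simps)
  then have "n * (1 - p * q) * W = n * (p * (Y - q) * W + f)"
    by (simp only: mult.assoc)
  then have "W = n * (p * (e * Y * W) * W) + n * f"
    by (simp add: cancel distrib_left eY)
  then have "f * W = f * (n * (p * (e * Y * W) * W)) + f * (n * f)"
    by (simp flip: distrib_left)
  moreover have "(1 - p * Y) * (W * W) = f * W"
    by (simp add: pY flip: mult.assoc)
  ultimately show "(1 - (p + f * n * p * e) * Y) * (W * W) = f * n * f"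
    by (simp add: algebra_simps)
qed

text \<open>Each step squares \<open>D\<close> and \<open>W\<close>, whence the exponent
  \<open>2 ^ k\<close>. The relations for \<open>E k\<close> and \<open>P k\<close> at
  \<open>X\<close> need each other, as do the two at \<open>Y\<close>, so they are carried
  together.\<close>

lemma doubling_invariant:
  fixes E P F Q :: "nat \<Rightarrow> linf_mat"
  assumes step: "\<And>k. E (Suc k) = E k * minv (1 - Q k * P k) * E k"
      "\<And>k. P (Suc k) = P k + F k * minv (1 - P k * Q k) * P k * E k"
      "\<And>k. F (Suc k) = F k * minv (1 - P k * Q k) * F k"
      "\<And>k. Q (Suc k) = Q k + E k * minv (1 - Q k * P k) * Q k * F k"
    and inv: "\<And>k. minvertible (1 - Q k * P k) \<and> minvertible (1 - P k * Q k)"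
    and init: "E 0 = (1 - Q 0 * X) * D" "X - P 0 = F 0 * X * D"
      "E 0 * Y * W = Y - Q 0" "(1 - P 0 * Y) * W = F 0"
  shows "E k = (1 - Q k * X) * D ^ 2 ^ k \<and> X - P k = F k * X * D ^ 2 ^ k \<and>
    E k * Y * W ^ 2 ^ k = Y - Q k \<and> (1 - P k * Y) * W ^ 2 ^ k = F k"
proof (induction k)
  case 0
  then show ?case using init by simp
next
  case (Suc k)
  then have h: "E k = (1 - Q k * X) * D ^ 2 ^ k" "X - P k = F k * X * D ^ 2 ^ k"
    "E k * Y * W ^ 2 ^ k = Y - Q k" "(1 - P k * Y) * W ^ 2 ^ k = F k"
    by blast+
  have n: "minv (1 - P k * Q k) * (1 - P k * Q k) = 1" "minv (1 - Q k * P k) * (1 - Q k * P k) = 1"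
    using minv_inverse(2) inv by blast+
  have square: "M ^ 2 ^ Suc k = M ^ 2 ^ k * M ^ 2 ^ k" for M :: linf_mat
    by (simp add: mult_2 flip: power_add)
  show ?case
    unfolding step square by (intro conjI; rule doubling_step[OF h n])
qed

text \<open>
  Eliminating \<open>F\<^sub>k\<close> from \<open>X - P\<^sub>k = F\<^sub>k X D\<^sub>k\<close> and \<open>F\<^sub>k = (1 - P\<^sub>k Y) W\<^sub>k\<close> leaves a linear equation
  for \<open>X - P\<^sub>k\<close> that is a small perturbation of \<open>X - P\<^sub>k = (1 - X Y) W\<^sub>k X D\<^sub>k\<close>.
\<close>

lemma doubling_error_bound:
  fixes X Y p W D :: "'a :: real_normed_algebra_1"
  assumes p: "X - p = (1 - p * Y) * W * X * D"
    and small: "norm Y * norm X * (norm W * norm D) \<le> 1 / 2"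
  shows "norm (X - p) \<le> 2 * norm (1 - X * Y) * norm X * (norm W * norm D)"
proof -
  let ?U = "W * X * D"
  have U: "norm ?U \<le> norm X * (norm W * norm D)"
  proof -
    have "norm ?U \<le> norm (W * X) * norm D" by (rule norm_mult_ineq)
    also have "\<dots> \<le> norm W * norm X * norm D" by (intro mult_right_mono norm_mult_ineq) simp
    finally show ?thesis by (simp add: mult_ac)
  qed
  have "norm (Y * ?U) \<le> norm Y * norm ?U" by (rule norm_mult_ineq)
  also have "\<dots> \<le> norm Y * (norm X * (norm W * norm D))" by (intro mult_left_mono U) simp
  finally have YU: "norm (Y * ?U) \<le> 1 / 2" using small by (simp add: mult.assoc)
  \<comment> \<open>Here \<open>1 - p * Y\<close> is split as
    \<open>(1 - X * Y) + (X - p) * Y\<close>; the bound \<open>1 / 2\<close> on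
    \<open>Y * ?U\<close> then lets half of the error be absorbed.\<close>
  have "X - p = (1 - X * Y) * ?U + (X - p) * (Y * ?U)"
    by (subst p) (simp add: algebra_simps)
  then have "norm (X - p) \<le> norm ((1 - X * Y) * ?U) + norm ((X - p) * (Y * ?U))"
    using norm_triangle_ineq[of "(1 - X * Y) * ?U" "(X - p) * (Y * ?U)"] by simp
  also have "\<dots> \<le> norm (1 - X * Y) * norm ?U + norm (X - p) * norm (Y * ?U)"
    by (intro add_mono norm_mult_ineq)
  also have "\<dots> \<le> norm (1 - X * Y) * (norm X * (norm W * norm D)) + norm (X - p) * (1 / 2)"
    by (intro add_mono mult_left_mono U YU norm_ge_zero)
  finally show ?thesis by (simp add: mult_ac)
qed

lemma filterlim_two_power: "filterlim (\<lambda>k::nat. 2 ^ k :: nat) at_top at_top"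
  by (rule filterlim_subseq) (simp add: strict_mono_def)

text \<open>The constant disappears because \<open>C powr (1 / 2 ^ k)\<close> tends to 1.\<close>

lemma limsup_root_le:
  fixes a :: "nat \<Rightarrow> real"
  assumes "C > 0" "t > 0" and a: "\<forall>\<^sub>F k in sequentially. a k \<le> C * t ^ 2 ^ k" and "\<And>k. a k \<ge> 0"
  shows "limsup (\<lambda>k. ereal (a k powr (1 / 2 ^ k))) \<le> ereal t"
proof -
  have "(\<lambda>k. 1 / 2 ^ k :: real) \<longlonglongrightarrow> 0"
    by (rule LIMSEQ_divide_realpow_zero) simp
  then have "(\<lambda>k. C powr (1 / 2 ^ k) * t) \<longlonglongrightarrow> C powr 0 * t"
    by (intro tendsto_intros) (use \<open>C > 0\<close> in auto)
  then have lim: "(\<lambda>k. ereal (C powr (1 / 2 ^ k) * t)) \<longlonglongrightarrow> ereal t"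
    using \<open>C > 0\<close> by simp
  have "\<forall>\<^sub>F k in sequentially. ereal (a k powr (1 / 2 ^ k)) \<le> ereal (C powr (1 / 2 ^ k) * t)"
    using a
  proof eventually_elim
    case (elim k)
    have "(t ^ 2 ^ k) powr (1 / 2 ^ k) = t"
      using \<open>t > 0\<close> by (simp add: powr_powr flip: powr_realpow)
    with elim show ?case
      using powr_mono2[of "1 / 2 ^ k" "a k" "C * t ^ 2 ^ k"] assms(1,2,4) by (simp add: powr_mult)
  qed
  then have "limsup (\<lambda>k. ereal (a k powr (1 / 2 ^ k)))
      \<le> limsup (\<lambda>k. ereal (C powr (1 / 2 ^ k) * t))"
    by (rule Limsup_mono)
  also have "\<dots> = ereal t"
    by (rule lim_imp_Limsup[OF _ lim]) simp
  finally show ?thesis .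
qed

text \<open>
  The deflating pairs of the initial pencil come from the factorisation
  \<open>\<lambda>\<^sup>2 - 2 \<lambda> + A\<^sub>1 = (\<lambda> - (2 - B)) (\<lambda> - B)\<close>: the solvent \<open>B\<close> gives \<open>[1; X]\<close>, and the solvent \<open>2 - B\<close>
  gives \<open>[1; 2 - B - T]\<close>, that is \<open>[Y; 1]\<close> with \<open>Y = (2 - B - T)\<^sup>-\<^sup>1 = V N\<^sup>-\<^sup>1\<close>.
\<close>

lemma initial_deflating_pairs:
  fixes A B T S V N Ni :: "'a :: ring_1"
  assumes A: "A = B + B - B * B" and S: "S * (2 - T) = 1"
    and V: "V * (2 - B) = 1" "(2 - B) * V = 1"
    and N: "N = 1 - T * V" "N * Ni = 1" "Ni * N = 1"
  defines "R \<equiv> T * T - (T + T) + A"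
  shows "S * A = (1 - S * (B - T)) * B"
    and "(B - T) - S * R = S * (B - T) * B"
    and "S * A * (V * Ni) * (N * V * Ni) = V * Ni - S"
    and "(1 - S * R * (V * Ni)) * (N * V * Ni) = S"
proof -
  have S': "S * ((2 - T) * z) = z" for z
    using arg_cong[OF S, of "\<lambda>t. t * z"] by (simp add: mult.assoc)
  have BV: "B * V = V + V - 1"
    using V(2) by (simp add: left_diff_distrib mult_2 algebra_simps)
  have BVz: "B * (V * z) = V * z + V * z - z" for z
    using arg_cong[OF BV, of "\<lambda>t. t * z"] by (simp add: algebra_simps)
  have Ni: "Ni * (N * z) = z" for z
    using arg_cong[OF N(3), of "\<lambda>t. t * z"] by (simp add: mult.assoc)
  \<comment> \<open>The factor \<open>2 - T\<close> is exposed so that \<open>S\<close> cancels it: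
    \<open>A = (2 - T) * B - (B - T) * B\<close>.\<close>
  have "S * A = S * ((2 - T) * B) - S * ((B - T) * B)"
    by (simp add: A algebra_simps mult_2)
  then show "S * A = (1 - S * (B - T)) * B"
    unfolding S' by (simp add: algebra_simps)
  have "S * R = S * ((2 - T) * (B - T)) - S * ((B - T) * B)"
    by (simp add: R_def A algebra_simps mult_2)
  then show "(B - T) - S * R = S * (B - T) * B"
    unfolding S' by (simp add: algebra_simps)
  have "A * (V * z) = B * z" for z
    by (simp add: A algebra_simps BVz)
  then have "S * A * (V * Ni) * (N * V * Ni) = S * (B * (V * Ni))"
    by (simp add: mult.assoc Ni)
  also have "\<dots> = S * ((2 - T) * (V * Ni)) - S * (N * Ni)"
    by (simp only: BVz right_diff_distrib[symmetric]) (simp add: N(1) algebra_simps mult_2)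
  finally show "S * A * (V * Ni) * (N * V * Ni) = V * Ni - S"
    by (simp add: S' N(2))
  \<comment> \<open>As \<open>N = (2 - B - T) * V\<close>, this is
    \<open>(2 - T) * (2 - B - T) = (2 - B - T) * (2 - B) + R\<close> multiplied by
    \<open>V * V\<close> from the right.\<close>
  have "(2 - T) * (N * V) = N + R * (V * V)"
    by (simp add: R_def A N(1) algebra_simps BV BVz mult_2)
  then have "S * ((2 - T) * (N * V)) * Ni = S * (N + R * (V * V)) * Ni"
    by simp
  then have "N * V * Ni = S * (N * Ni) + S * R * (V * V) * Ni"
    unfolding S' by (simp add: algebra_simps)
  then have "N * V * Ni - S * R * (V * V) * Ni = S"
    by (simp add: N(2))
  moreover have "S * R * (V * Ni) * (N * V * Ni) = S * R * (V * V) * Ni"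
    by (simp add: mult.assoc Ni)
  ultimately show "(1 - S * R * (V * Ni)) * (N * V * Ni) = S"
    by (simp only: left_diff_distrib mult_1_left)
qed

text \<open>From \<open>2 * V = 1 + B * V\<close> one gets
  \<open>2 * norm V \<le> 1 + norm V\<close>. It keeps the powers of \<open>V\<close>
  bounded.\<close>

lemma norm_minv_two_minus_le:
  assumes "norm B < 1"
  shows "norm (minv (2 - B)) \<le> 1"
proof -
  let ?V = "minv (2 - B)"
  have "(2 - B) * ?V = 1"
    using assms by (intro minv_inverse minvertible_two_minus) simp
  then have "2 *\<^sub>R ?V = 1 + B * ?V"
    by (simp add: scaleR_2 algebra_simps mult_2)
  then have "norm (2 *\<^sub>R ?V) = norm (1 + B * ?V)" by (rule arg_cong)
  then have "2 * norm ?V = norm (1 + B * ?V)" by simp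
  also have "\<dots> \<le> 1 + norm B * norm ?V"
    by (rule norm_triangle_le) (simp add: norm_mult_ineq)
  also have "\<dots> \<le> 1 + 1 * norm ?V"
    using assms by (intro add_left_mono mult_right_mono) auto
  finally show ?thesis by simp
qed

lemma power_conjugate:
  fixes N V M :: "'a :: ring_1"
  assumes "M * N = 1" "N * M = 1"
  shows "(N * V * M) ^ n = N * V ^ n * M"
proof (induction n)
  case (Suc n)
  have "(N * V * M) ^ Suc n = N * V * (M * N) * V ^ n * M"
    unfolding power_Suc Suc by (simp only: mult.assoc)
  also have "\<dots> = N * V ^ Suc n * M" by (simp add: assms mult.assoc)
  finally show ?case .
qed (simp add: assms)

theorem theorem3p4:
  fixes A A1 B E\<^sub>B S R V Z :: linf_mat
    and b :: "int \<Rightarrow> complex"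
    and E P F Q :: "nat \<Rightarrow> linf_mat"
  assumes "A = 1 - A1" and "A \<in> QT" and "nonneg_mat A1" and "norm A1 < 1"
    and "b \<in> wiener" and "E\<^sub>B \<in> K_d" and "B = toeplitz b + E\<^sub>B"
    and "M_matrix (1 - B)" and "(1 - B)\<^sup>2 = A"
    and unique: "\<And>C. M_matrix C \<Longrightarrow> C\<^sup>2 = A \<Longrightarrow> C = 1 - B"
    and "S = minv (2 - toeplitz b)"
    and "R = (toeplitz b)\<^sup>2 - 2 * toeplitz b + A1"
    and "E 0 = S * A1" and "P 0 = S * R" and "F 0 = S" and "Q 0 = S"
    and "\<And>k. E (Suc k) = E k * minv (1 - Q k * P k) * E k"
    and "\<And>k. P (Suc k) = P k + F k * minv (1 - P k * Q k) * P k * E k"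
    and "\<And>k. F (Suc k) = F k * minv (1 - P k * Q k) * F k"
    and "\<And>k. Q (Suc k) = Q k + E k * minv (1 - Q k * P k) * Q k * F k"
    and no_breakdown: "\<And>k. minvertible (1 - Q k * P k) \<and> minvertible (1 - P k * Q k)"
    and "V = minv (2 - B)"
    and "Z = (1 - toeplitz b * V) * minv (2 - B) * minv (1 - toeplitz b * V)"
  shows "P \<longlonglongrightarrow> E\<^sub>B \<and>
    limsup (\<lambda>k. ereal (norm (E\<^sub>B - P k) powr (1 / 2 ^ k)))
      \<le> ereal (spectral_radius B * spectral_radius Z)"
proof -
  define T where "T = toeplitz b"
  define N where "N = 1 - T * V"
  define Y where "Y = V * minv N"
  have root: "(1 - B)\<^sup>2 = 1 - A1" using assms(1,9) by simp
  have nB: "norm B < 1"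
    by (rule norm_lt_one_of_M_matrix_root[OF \<open>M_matrix (1 - B)\<close> root \<open>norm A1 < 1\<close>])
  have nT: "norm T < 1"
    using norm_toeplitz_le[OF \<open>b \<in> wiener\<close> \<open>E\<^sub>B \<in> K_d\<close>] nB \<open>B = _\<close> by (simp add: T_def)
  have nV: "norm V \<le> 1"
    unfolding \<open>V = _\<close> by (rule norm_minv_two_minus_le[OF nB])
  have "norm (T * V) \<le> norm T * norm V" by (rule norm_mult_ineq)
  also have "\<dots> \<le> norm T * 1" using nV by (intro mult_left_mono) auto
  finally have "norm (T * V) < 1" using nT by simp
  then have "minvertible N"
    unfolding N_def by (intro minvertible_one_minus summable_norm_power)
  note N = minv_inverse[OF this]
  have "minvertible (2 - B)" "minvertible (2 - T)"
    using nB nT by (auto intro: minvertible_two_minus)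
  then have V: "V * (2 - B) = 1" "(2 - B) * V = 1" and S: "S * (2 - T) = 1"
    using minv_inverse unfolding \<open>V = _\<close> \<open>S = _\<close> T_def by auto
  have A1: "A1 = B + B - B * B"
    using root by (simp add: power2_eq_square algebra_simps)
  have R: "R = T * T - (T + T) + A1"
    unfolding \<open>R = _\<close> T_def by (simp add: power2_eq_square mult_2)
  have X: "E\<^sub>B = B - T" using \<open>B = _\<close> by (simp add: T_def)
  have Z: "Z = N * V * minv N"
    unfolding \<open>Z = _\<close> N_def T_def \<open>V = _\<close> ..
  note init = initial_deflating_pairs[OF A1 S V N_def N, folded R X Y_def Z]
  have inv: "E k = (1 - Q k * E\<^sub>B) * B ^ 2 ^ k \<and> E\<^sub>B - P k = F k * E\<^sub>B * B ^ 2 ^ k \<and>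
      E k * Y * Z ^ 2 ^ k = Y - Q k \<and> (1 - P k * Y) * Z ^ 2 ^ k = F k" for k
    by (rule doubling_invariant[where E = E and P = P and F = F and Q = Q,
          OF assms(17-20) no_breakdown])
      (unfold \<open>E 0 = _\<close> \<open>P 0 = _\<close> \<open>F 0 = _\<close> \<open>Q 0 = _\<close>, (rule init)+)
  then have eq: "E\<^sub>B - P k = (1 - P k * Y) * Z ^ 2 ^ k * E\<^sub>B * B ^ 2 ^ k" for k
    by simp
  define \<delta> where "\<delta> k = norm (Z ^ 2 ^ k) * norm (B ^ 2 ^ k)" for k :: nat
  define K where "K = 2 * norm (1 - E\<^sub>B * Y) * norm E\<^sub>B"
  have K: "K \<ge> 0" by (simp add: K_def)
  \<comment> \<open>Convergence is settled before the rate: similarity to \<open>V\<close> bounds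
    the powers of \<open>Z\<close>, so the decay of the powers of \<open>B\<close> drives
    \<open>\<delta>\<close> to zero.\<close>
  have "norm (Z ^ n) \<le> norm N * norm (minv N)" for n
  proof -
    have "norm (V ^ n) \<le> 1"
      using norm_power_ineq[of V n] power_le_one[OF norm_ge_zero nV, of n] by linarith
    then have "norm N * norm (V ^ n) * norm (minv N) \<le> norm N * 1 * norm (minv N)"
      by (intro mult_right_mono mult_left_mono) auto
    moreover have "norm (Z ^ n) \<le> norm (N * V ^ n) * norm (minv N)"
      unfolding Z power_conjugate[OF N(2,1)] by (rule norm_mult_ineq)
    moreover have "norm (N * V ^ n) * norm (minv N) \<le> norm N * norm (V ^ n) * norm (minv N)"
      by (intro mult_right_mono norm_mult_ineq) simp
    ultimately show ?thesis by simp
  qed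
  then have \<delta>_le: "\<delta> k \<le> norm N * norm (minv N) * norm B ^ 2 ^ k" for k
    unfolding \<delta>_def by (intro mult_mono norm_power_ineq) auto
  have "(\<lambda>k. norm B ^ 2 ^ k) \<longlonglongrightarrow> 0"
    by (rule filterlim_compose[OF LIMSEQ_realpow_zero filterlim_two_power]) (use nB in auto)
  then have "(\<lambda>k. norm N * norm (minv N) * norm B ^ 2 ^ k) \<longlonglongrightarrow> 0"
    by (rule tendsto_mult_right_zero)
  then have \<delta>: "\<delta> \<longlonglongrightarrow> 0"
    by (rule tendsto_sandwich[OF _ _ tendsto_const, rotated -1]) (auto simp: \<delta>_def \<delta>_le[unfolded \<delta>_def])
  have "(\<lambda>k. norm Y * norm E\<^sub>B * \<delta> k) \<longlonglongrightarrow> 0"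
    by (rule tendsto_mult_right_zero[OF \<delta>])
  then have "\<forall>\<^sub>F k in sequentially. norm Y * norm E\<^sub>B * \<delta> k < 1 / 2"
    by (rule order_tendstoD) simp
  then have err: "\<forall>\<^sub>F k in sequentially. norm (E\<^sub>B - P k) \<le> K * \<delta> k"
  proof eventually_elim
    case (elim k)
    then show ?case
      unfolding K_def \<delta>_def by (intro doubling_error_bound[OF eq]) simp
  qed
  have "(\<lambda>k. E\<^sub>B - P k) \<longlonglongrightarrow> 0"
    by (rule Lim_null_comparison[OF err tendsto_mult_right_zero[OF \<delta>]])
  then have "(\<lambda>k. E\<^sub>B - (E\<^sub>B - P k)) \<longlonglongrightarrow> E\<^sub>B - 0"
    by (intro tendsto_diff tendsto_const)
  then have lim: "P \<longlonglongrightarrow> E\<^sub>B" by simp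
  let ?L = "limsup (\<lambda>k. ereal (norm (E\<^sub>B - P k) powr (1 / 2 ^ k)))"
  \<comment> \<open>The power bounds need rates strictly above the spectral radii; \<open>r\<close>
    and \<open>s\<close> are sent down to them at the end.\<close>
  have limsup_le: "?L \<le> ereal (r * s)" if r: "r > spectral_radius B" and s: "s > spectral_radius Z" for r s
  proof -
    have rs: "r > 0" "s > 0"
      using r s spectral_radius_nonneg[of B] spectral_radius_nonneg[of Z] by linarith+
    obtain M where M: "M > 0" "\<And>n. norm (B ^ n) \<le> M * r ^ n" using power_bound[OF r] by blast
    obtain M' where M': "M' > 0" "\<And>n. norm (Z ^ n) \<le> M' * s ^ n" using power_bound[OF s] by blast
    show ?thesis
    \<comment> \<open>\<open>K + 1\<close> replaces \<open>K\<close> to have a positive constant,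
      since \<open>K\<close> vanishes when \<open>E\<^sub>B = 0\<close>.\<close>
    proof (rule limsup_root_le[where C = "(K + 1) * (M' * M)"])
      show "\<forall>\<^sub>F k in sequentially. norm (E\<^sub>B - P k) \<le> (K + 1) * (M' * M) * (r * s) ^ 2 ^ k"
        using err
      proof eventually_elim
        case (elim k)
        have "\<delta> k \<le> (M' * s ^ 2 ^ k) * (M * r ^ 2 ^ k)"
          unfolding \<delta>_def using M' rs by (intro mult_mono M(2) M'(2)) auto
        then have "K * \<delta> k \<le> (K + 1) * ((M' * s ^ 2 ^ k) * (M * r ^ 2 ^ k))"
          using K M'(1) M(1) rs by (intro mult_mono) (auto simp: \<delta>_def)
        with elim show ?case by (simp add: power_mult_distrib mult_ac)
      qed
    qed (use K M(1) M'(1) rs in auto)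
  qed
  let ?\<epsilon> = "\<lambda>n. inverse (real (Suc n))"
  have "(\<lambda>n. (spectral_radius B + ?\<epsilon> n) * (spectral_radius Z + ?\<epsilon> n))
      \<longlonglongrightarrow> spectral_radius B * spectral_radius Z"
    by (intro tendsto_mult LIMSEQ_inverse_real_of_nat_add)
  then have "(\<lambda>n. ereal ((spectral_radius B + ?\<epsilon> n) * (spectral_radius Z + ?\<epsilon> n)))
      \<longlonglongrightarrow> ereal (spectral_radius B * spectral_radius Z)"
    by (rule tendsto_ereal)
  then have "?L \<le> ereal (spectral_radius B * spectral_radius Z)"
    by (rule LIMSEQ_le_const) (auto intro!: exI[of _ 0] limsup_le)
  with lim show ?thesis by blast
qed

end
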